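(* For each $n \in \mathbb{N}$, there exist an $n$-dimensional simple polytope $P$ with $3n$ facets, a vertex $\mathbf{v}$ of $P$, and $\mathbf{c} \in \mathbb{R}^n$ such that any shadow path on $P$ starting at $\mathbf{v}$ to optimize (maximize) $\mathbf{c}^{\intercal}\mathbf{x}$ is of length at least $2^n$. Hence, there is no strongly polynomial time shadow simplex algorithm for linear programming, regardless of how the shadow is chosen.
   Context: An $n$-dimensional polytope is simple if each of its vertices lies in precisely $n$ facets. For a vertex $\mathbf{v}$ of a polytope $P\subset\mathbb{R}^n$, its normal cone is $C_{\mathbf{v}} = \{\mathbf{z}\in\mathbb{R}^n : \mathbf{z}^{\intercal}\mathbf{v} \ge \mathbf{z}^{\intercal}\mathbf{x} \text{ for all } \mathbf{x}\in P\}$. Shadow path: let $\mathbf{v}$ be a vertex of $P$ and let $\mathbf{c}$ be uniquely maximized over $P$ at a vertex $\mathbf{v}^*$. A shadow path from $\mathbf{v}$ for maximizing $\mathbf{c}^{\intercal}\mathbf{x}$ is determined by an auxiliary vector $\mathbf{w}$ in the interior of $C_{\mathbf{v}}$ (i.e. $\mathbf{w}$ is uniquely maximized over $P$ at $\mathbf{v}$). It is the path consisting of every vertex of $P$ that maximizes $\lambda\mathbf{w}+(1-\lambda)\mathbf{c}$ for some $\lambda\in[0,1]$, listed as $\lambda$ decreases from $1$ to $0$. Precisely, it is a sequence of vertices $\mathbf{v}=\mathbf{v}_0,\mathbf{v}_1,\dots,\mathbf{v}_\ell=\mathbf{v}^*$, with consecutive vertices joined by an edge of $P$, such that there are $1=\lambda_0>\lambda_1>\dots>\lambda_\ell=0$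 with $\mathbf{v}_i$ the unique maximizer over $P$ of $\lambda_i\mathbf{w}+(1-\lambda_i)\mathbf{c}$, and such that every vertex of $P$ maximizing $\lambda\mathbf{w}+(1-\lambda)\mathbf{c}$ for some $\lambda\in[0,1]$ is one of the $\mathbf{v}_i$. Its length is $\ell$, the number of edges. Equivalently, the path is obtained by following the boundary of the polygon (the shadow) that is the image of $P$ under $\mathbf{x}\mapsto(-\mathbf{w}^{\intercal}\mathbf{x},\mathbf{c}^{\intercal}\mathbf{x})$. Different choices of $\mathbf{w}$ in the interior of $C_{\mathbf{v}}$, i.e. different choices of the shadow, may give different shadow paths. A shadow simplex algorithm is a simplex method which, from a given initial vertex, picks such a $\mathbf{w}$ and follows the corresponding shadow path, one edge per step.
   Formalization: The claim is taken for n ≥ 2 rather than for each natural number n: for n = 1 it is false, since a 1-dimensional polytope is a segment with 2 facets, not 3, and has no path of length 2; n = 0 (a point) is degenerate. *)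

theory Defs
  imports "HOL-Analysis.Analysis" "HOL-Analysis.Finite_Function_Topology"
    "HOL-Computational_Algebra.Polynomial"
begin

text \<open>
  The dimension varies inside the statement, so R^n is not a type here: all vectors live in the
  library's real vector space of finitely supported functions \<^typ>\<open>nat \<Rightarrow>\<^sub>0 real\<close>, and R^n is the
  subspace of those supported on the first n indices. The library notions
  \<^const>\<open>polytope\<close>, \<^const>\<open>face_of\<close>, \<^const>\<open>extreme_point_of\<close> (vertex) only need a real
  vector space and are used as they are. \<^const>\<open>aff_dim\<close>, \<^const>\<open>facet_of\<close> and \<^const>\<open>edge_of\<close>
  are restricted to Euclidean spaces, so their counterparts over a real vector space are given below.
\<close>

type_synonym rvec = "nat \<Rightarrow>\<^sub>0 real"

definition Rn :: "nat \<Rightarrow> rvec set" where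
  "Rn n = {x. Poly_Mapping.keys x \<subseteq> {..<n}}"

definition dotp :: "rvec \<Rightarrow> rvec \<Rightarrow> real" where
  "dotp z x = (\<Sum>i\<in>Poly_Mapping.keys z. Poly_Mapping.lookup z i * Poly_Mapping.lookup x i)"

lemma dotp_Rn:
  assumes "z \<in> Rn n"
  shows "dotp z x = (\<Sum>i<n. Poly_Mapping.lookup z i * Poly_Mapping.lookup x i)"
  unfolding dotp_def
  by (rule sum.mono_neutral_left) (use assms in \<open>auto simp: Rn_def in_keys_iff\<close>)

definition adim :: "'a::real_vector set \<Rightarrow> int" where
  "adim S = (if S = {} then - 1 else int (dim {x - y |x y. x \<in> S \<and> y \<in> S}))"

lemma adim_eq_aff_dim:
  fixes S :: "'a::euclidean_space set"
  shows "adim S = aff_dim S"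
proof (cases "S = {}")
  case False
  then obtain a where a: "a \<in> S" by auto
  let ?D = "{x - y |x y. x \<in> S \<and> y \<in> S}" and ?T = "(+) (- a) ` S"
  have T: "?T \<subseteq> ?D" using a by force
  have D: "?D \<subseteq> span ?T"
  proof
    fix d assume "d \<in> ?D"
    then obtain x y where "x \<in> S" "y \<in> S" and d: "d = x - y" by auto
    then have "- a + x \<in> span ?T" "- a + y \<in> span ?T" by (auto intro: span_base)
    then have "(- a + x) - (- a + y) \<in> span ?T" by (rule span_diff)
    then show "d \<in> span ?T" by (simp add: d)
  qed
  have "dim ?D = dim ?T"
    using dim_subset[OF T] dim_subset[OF D] by (simp add: dim_span)
  moreover have "aff_dim S = int (dim ?T)"
    by (rule aff_dim_eq_dim) (use a in \<open>simp add: hull_inc\<close>)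
  ultimately show ?thesis using False by (simp add: adim_def)
qed (simp add: adim_def)

definition facet :: "'a::real_vector set \<Rightarrow> 'a set \<Rightarrow> bool" where
  "facet P F \<longleftrightarrow> F face_of P \<and> F \<noteq> {} \<and> adim F = adim P - 1"

definition edge :: "'a::real_vector set \<Rightarrow> 'a set \<Rightarrow> bool" where
  "edge P e \<longleftrightarrow> e face_of P \<and> adim e = 1"

definition simple_polytope :: "'a::real_vector set \<Rightarrow> bool" where
  "simple_polytope P \<longleftrightarrow> polytope P \<and>
     (\<forall>v. v extreme_point_of P \<longrightarrow> int (card {F. facet P F \<and> v \<in> F}) = adim P)"

definition maximized_at :: "rvec set \<Rightarrow> rvec \<Rightarrow> rvec \<Rightarrow> bool" where
  "maximized_at P z v \<longleftrightarrow> v \<in> P \<and> (\<forall>x\<in>P. dotp z x \<le> dotp z v)"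

definition uniquely_maximized_at :: "rvec set \<Rightarrow> rvec \<Rightarrow> rvec \<Rightarrow> bool" where
  "uniquely_maximized_at P z v \<longleftrightarrow> maximized_at P z v \<and> (\<forall>x. maximized_at P z x \<longrightarrow> x = v)"

definition normal_cone :: "nat \<Rightarrow> rvec set \<Rightarrow> rvec \<Rightarrow> rvec set" where
  "normal_cone n P v = {z \<in> Rn n. \<forall>x\<in>P. dotp z v \<ge> dotp z x}"

text \<open>
  A path is the list of the vertices it visits. The interior of the normal cone is taken relative
  to R^n. With \<open>l = length vs - 1\<close> edges, the requirement \<open>lam 0 = 1\<close>, \<open>lam l = 0\<close> forces \<open>l \<ge> 1\<close>:
  there is a shadow path from \<open>v\<close> only if \<open>v\<close> is not already optimal. Also, the vertices are
  required to be joined by edges, so a degenerate \<open>w\<close> (for which two consecutive unique maximizers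
  are not adjacent) determines no shadow path.
\<close>

definition path_length :: "rvec list \<Rightarrow> nat" where
  "path_length vs = length vs - 1"

definition shadow_path :: "nat \<Rightarrow> rvec set \<Rightarrow> rvec \<Rightarrow> rvec \<Rightarrow> rvec \<Rightarrow> rvec list \<Rightarrow> bool" where
  "shadow_path n P v c w vs \<longleftrightarrow>
     w \<in> (top_of_set (Rn n)) interior_of (normal_cone n P v) \<and>
     vs \<noteq> [] \<and> hd vs = v \<and>
     (\<forall>u\<in>set vs. u extreme_point_of P) \<and>
     (\<forall>i < path_length vs. edge P (closed_segment (vs ! i) (vs ! Suc i))) \<and>
     (\<exists>lam :: nat \<Rightarrow> real.
        lam 0 = 1 \<and> lam (path_length vs) = 0 \<and>
        (\<forall>i < path_length vs. lam i > lam (Suc i)) \<and>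
        (\<forall>i \<le> path_length vs.
           uniquely_maximized_at P (lam i *\<^sub>R w + (1 - lam i) *\<^sub>R c) (vs ! i))) \<and>
     (\<forall>u t. u extreme_point_of P \<and> 0 \<le> t \<and> t \<le> 1 \<and>
        maximized_at P (t *\<^sub>R w + (1 - t) *\<^sub>R c) u \<longrightarrow> u \<in> set vs)"

text \<open>
  A linear program: maximize \<open>c\<^sup>T x\<close> subject to \<open>a\<^sup>T x \<le> b\<close> for each row \<open>(a, b)\<close>, with a
  given initial vertex.
\<close>

record lp =
  lp_dim :: nat
  lp_rows :: "(rvec \<times> real) list"
  lp_obj :: rvec
  lp_start :: rvec

definition feasible :: "lp \<Rightarrow> rvec set" where
  "feasible L = {x \<in> Rn (lp_dim L). \<forall>(a, b) \<in> set (lp_rows L). dotp a x \<le> b}"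

definition rational_vec :: "nat \<Rightarrow> rvec \<Rightarrow> bool" where
  "rational_vec n x \<longleftrightarrow> x \<in> Rn n \<and> (\<forall>i. Poly_Mapping.lookup x i \<in> \<rat>)"

text \<open>
  The inputs on which a shadow simplex algorithm has to work: rational data (as usual for strong
  polynomiality), a bounded feasible region, an initial vertex, and a unique optimum which is not
  the initial vertex. An algorithm for real data is in particular one for these inputs.
\<close>

definition shadow_instance :: "lp \<Rightarrow> bool" where
  "shadow_instance L \<longleftrightarrow>
     (\<forall>(a, b) \<in> set (lp_rows L). rational_vec (lp_dim L) a \<and> b \<in> \<rat>) \<and>
     rational_vec (lp_dim L) (lp_obj L) \<and> rational_vec (lp_dim L) (lp_start L) \<and>
     polytope (feasible L) \<and> lp_start L extreme_point_of feasible L \<and>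
     (\<exists>vopt. vopt \<noteq> lp_start L \<and> uniquely_maximized_at (feasible L) (lp_obj L) vopt)"

text \<open>Number of numbers in the input: constraint matrix, right-hand side, objective, vertex.\<close>

definition input_size :: "lp \<Rightarrow> nat" where
  "input_size L = length (lp_rows L) * lp_dim L + length (lp_rows L) + lp_dim L + lp_dim L"

text \<open>
  An algorithm enters only through what it does on each input \<open>L\<close>: the auxiliary vector
  \<open>aux L\<close> that it picks, by whatever rule, the path \<open>route L\<close> that it follows, and the number
  \<open>ops L\<close> of arithmetic operations that it spends, at least one for each edge.
\<close>

definition shadow_simplex_algorithm ::
  "(lp \<Rightarrow> rvec) \<Rightarrow> (lp \<Rightarrow> rvec list) \<Rightarrow> (lp \<Rightarrow> nat) \<Rightarrow> bool" where
  "shadow_simplex_algorithm aux route ops \<longleftrightarrow>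
     (\<forall>L. shadow_instance L \<longrightarrow>
        shadow_path (lp_dim L) (feasible L) (lp_start L) (lp_obj L) (aux L) (route L) \<and>
        path_length (route L) \<le> ops L)"

text \<open>
  Strong polynomiality also bounds the sizes of the intermediate numbers; only the bound on the
  number of operations is recorded, so excluding it excludes more.
\<close>

definition strongly_polynomial_time :: "(lp \<Rightarrow> nat) \<Rightarrow> bool" where
  "strongly_polynomial_time ops \<longleftrightarrow>
     (\<exists>p :: nat poly. \<forall>L. shadow_instance L \<longrightarrow> ops L \<le> poly p (input_size L))"

end

theory Submission
  imports Defs
begin

text \<open>
  Start from a Klee-Minty cube with a fixed shadow path, for \<open>w = (-1, \<dots>, -1)\<close> in the normal cone of the
  vertex 0, that visits all \<open>2\<^sup>n\<close> vertices: the multipliers in the optimality conditions follow iterates of a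
  tent map in the shadow parameter, so every sign pattern occurs. Cut off the vertex 0 by \<open>n\<close> halfspaces whose
  normals are tiny perturbations of \<open>w\<close>. They meet in a new vertex, the apex, whose normal cone is so narrow
  around \<open>w\<close> that every shadow path starting there still visits the other \<open>2\<^sup>n - 1\<close> vertices of the cube.
  Together with the apex and one more new vertex, on the edge along which the old path left 0, this gives
  \<open>2\<^sup>n + 1\<close> vertices.
\<close>

subsection \<open>Vectors with coordinates below \<open>n\<close>\<close>

text \<open>The order and adjacency of the visited vertices never have to be analysed. A shadow path
  must list every vertex that maximizes some combination of \<open>w\<close> and \<open>c\<close>,
  even a vertex that is not the only maximizer. So one parameter per vertex suffices, with
  multipliers of weakly correct sign, and the length follows by counting. What must be robust is the
  sign pattern. At the chosen parameter the unperturbed multipliers have absolute value at least 1.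
  A vector \<open>w\<close> from the cone of the apex, scaled to mean -1, is so close to (-1, ...,
  -1) that a correction of size at most 1 restores the equations. The optimality argument uses only
  rows of the uncut cube, so it stays valid on the smaller polytope. A single cut would make the
  cone no narrower; \<open>n\<close> nearly parallel cuts meeting in one point do, while that point
  lies in exactly \<open>n\<close> facets. In dimension 1 three facets are impossible, hence
  \<open>2 \<le> n\<close>.\<close>

abbreviation coord :: "rvec \<Rightarrow> nat \<Rightarrow> real" where
  "coord \<equiv> Poly_Mapping.lookup"

lemma coord_scaleR [simp]: "coord (r *\<^sub>R x) i = r * coord x i"
  by (simp add: scaleR_poly_mapping_def Poly_Mapping.map.rep_eq when_def)

lemma subspace_Rn: "subspace (Rn n)"
  by (auto simp: subspace_def Rn_def in_keys_iff lookup_add subset_eq)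

lemmas Rn_0 [simp] = subspace_0[OF subspace_Rn]
  and Rn_add [simp] = subspace_add[OF subspace_Rn]
  and Rn_diff [simp] = subspace_diff[OF subspace_Rn]
  and Rn_uminus [simp] = subspace_neg[OF subspace_Rn]
  and Rn_scaleR [simp] = subspace_scale[OF subspace_Rn]

lemma linear_dotp: "linear (dotp z)"
  by (rule linearI) (simp_all add: dotp_def lookup_add sum.distrib sum_distrib_left algebra_simps)

lemmas dotp_add_right [simp] = linear_add[OF linear_dotp]
  and dotp_diff_right [simp] = linear_diff[OF linear_dotp]
  and dotp_minus_right [simp] = linear_neg[OF linear_dotp]
  and dotp_scaleR_right [simp] = linear_scale[OF linear_dotp, unfolded real_scaleR_def]
  and dotp_zero_right [simp] = linear_0[OF linear_dotp]

lemma dotp_add_left: "w \<in> Rn n \<Longrightarrow> z \<in> Rn n \<Longrightarrow> dotp (w + z) x = dotp w x + dotp z x"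
  by (simp add: dotp_Rn[of _ n] lookup_add sum.distrib algebra_simps)

lemma dotp_scaleR_left: "z \<in> Rn n \<Longrightarrow> dotp (r *\<^sub>R z) x = r * dotp z x"
  by (simp add: dotp_Rn[of _ n] sum_distrib_left algebra_simps)

definition rvec_of :: "nat \<Rightarrow> (nat \<Rightarrow> real) \<Rightarrow> rvec" where
  "rvec_of n f = Abs_poly_mapping (\<lambda>i. if i < n then f i else 0)"

lemma coord_rvec_of [simp]: "coord (rvec_of n f) i = (if i < n then f i else 0)"
proof -
  have "finite {i. (if i < n then f i else 0) \<noteq> 0}"
    by (rule finite_subset[of _ "{..<n}"]) auto
  then show ?thesis by (simp add: rvec_of_def)
qed

lemma rvec_of_in_Rn [simp]: "rvec_of n f \<in> Rn n"
  by (auto simp: Rn_def in_keys_iff split: if_splits)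

lemma coord_outside_Rn: "x \<in> Rn n \<Longrightarrow> n \<le> i \<Longrightarrow> coord x i = 0"
  by (auto simp: Rn_def in_keys_iff)

lemma rvec_eqI: "x \<in> Rn n \<Longrightarrow> y \<in> Rn n \<Longrightarrow> (\<And>i. i < n \<Longrightarrow> coord x i = coord y i) \<Longrightarrow> x = y"
  by (rule poly_mapping_eqI) (metis coord_outside_Rn not_less)

lemma dotp_rvec_of: "dotp (rvec_of n f) x = (\<Sum>i<n. f i * coord x i)"
  by (simp add: dotp_Rn[of _ n])

lemma Rn_Suc_eq: "x \<in> Rn (Suc n) \<Longrightarrow> coord x n = 0 \<Longrightarrow> x \<in> Rn n"
  by (auto simp: Rn_def in_keys_iff subset_eq less_Suc_eq) 

text \<open>A basis of the kernel of \<open>f\<close> in \<open>K\<close> together with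
  \<open>d\<close> is a basis of \<open>K\<close>. The finite spanning set \<open>W\<close> makes it
  finite, so that \<open>card\<close> counts it correctly.\<close>

lemma dim_kernel:
  fixes f :: "'a::real_vector \<Rightarrow> real"
  assumes K: "subspace K" and f: "linear f" and d: "d \<in> K" "f d \<noteq> 0"
    and W: "finite W" "K \<subseteq> span W"
  shows "dim K = Suc (dim {x \<in> K. f x = 0})"
proof -
  let ?K0 = "{x \<in> K. f x = 0}"
  have K0: "subspace ?K0"
    using K unfolding subspace_def
    by (simp add: linear_add[OF f] linear_scale[OF f] linear_0[OF f])
  obtain B where B: "B \<subseteq> ?K0" "independent B" "?K0 \<subseteq> span B" "card B = dim ?K0"
    by (rule basis_exists)
  have finB: "finite B"
    using independent_span_bound[OF W(1) B(2)] B(1) W(2) by blast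
  have spanB: "span B \<subseteq> ?K0"
    by (rule span_minimal[OF B(1) K0])
  have dB: "d \<notin> span B" "d \<notin> B"
    using spanB d B(1) by auto
  show ?thesis
  proof (rule dim_unique)
    show "insert d B \<subseteq> K" using B(1) d by auto
    show "K \<subseteq> span (insert d B)"
    proof
      fix x assume x: "x \<in> K"
      have "x - (f x / f d) *\<^sub>R d \<in> ?K0"
        using subspace_diff[OF K x subspace_scale[OF K d(1)]] d(2)
        by (simp add: linear_diff[OF f] linear_scale[OF f])
      with B(3) show "x \<in> span (insert d B)"
        unfolding span_breakdown_eq by blast
    qed
    show "independent (insert d B)" using dB B(2) by (simp add: independent_insertI)
    show "card (insert d B) = Suc (dim ?K0)" using finB dB B(4) by simp
  qed
qed

text \<open>The finite spanning set is carried along because \<open>dim_kernel\<close>, applied to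
  the last coordinate in the induction step, asks for one.\<close>

lemma dim_Rn: "(\<exists>W. finite W \<and> Rn n \<subseteq> span W) \<and> dim (Rn n) = n"
proof (induction n)
  case 0
  have "Rn 0 = {0}" by (auto simp: Rn_def)
  moreover have "dim {0 :: rvec} = 0"
    by (rule dim_unique[of "{}"]) (auto simp: independent_empty)
  ultimately show ?case by (intro conjI exI[of _ "{}"]) auto
next
  case (Suc n)
  then obtain W where W: "finite W" "Rn n \<subseteq> span W" and n: "dim (Rn n) = n" by auto
  define d where "d = rvec_of (Suc n) (\<lambda>i. if i = n then 1 else 0)"
  have sub: "Rn (Suc n) \<subseteq> span (insert d W)"
  proof
    fix x assume x: "x \<in> Rn (Suc n)"
    have "x - coord x n *\<^sub>R d \<in> Rn n"
      by (rule Rn_Suc_eq) (use x in \<open>auto simp: d_def lookup_minus\<close>)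
    with W show "x \<in> span (insert d W)" by (auto simp: span_breakdown_eq)
  qed
  have ker: "{x \<in> Rn (Suc n). coord x n = 0} = Rn n"
    using Rn_Suc_eq by (auto simp: coord_outside_Rn) (auto simp: Rn_def)
  have "linear (\<lambda>x. coord x n)" by (rule linearI) (simp_all add: lookup_add)
  then have "dim (Rn (Suc n)) = Suc (dim {x \<in> Rn (Suc n). coord x n = 0})"
    by (rule dim_kernel[OF subspace_Rn _ _ _ _ sub, of _ d]) (use W in \<open>auto simp: d_def\<close>)
  then show ?case using W sub n ker by (metis finite_insert)
qed

lemma segment_through:
  fixes x :: "'a::real_vector"
  assumes "s > 0" "t > 0" "d \<noteq> 0"
  shows "x \<in> open_segment (x + s *\<^sub>R d) (x + t *\<^sub>R - d)"
proof -
  define u where "u = s / (s + t)"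
  have u: "(1 - u) * s - u * t = 0" "0 < u" "u < 1"
    using assms by (auto simp: u_def field_simps)
  have "(1 - u) *\<^sub>R (x + s *\<^sub>R d) + u *\<^sub>R (x + t *\<^sub>R - d) = x + ((1 - u) * s - u * t) *\<^sub>R d"
    by (simp add: algebra_simps)
  then have "x = (1 - u) *\<^sub>R (x + s *\<^sub>R d) + u *\<^sub>R (x + t *\<^sub>R - d)"
    by (simp add: u)
  moreover have "x + s *\<^sub>R d \<noteq> x + t *\<^sub>R - d"
  proof
    assume "x + s *\<^sub>R d = x + t *\<^sub>R - d"
    then have "(s + t) *\<^sub>R d = 0" by (simp add: scaleR_add_left)
    with assms show False by simp
  qed
  ultimately show ?thesis
    using u unfolding in_segment by blast
qed

subsection \<open>Polytopes given by nondegenerate inequality systems\<close>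

text \<open>
  The assumption \<open>dual_vector\<close> says that the normals of the rows that are tight at a point are linearly
  independent; this makes the polytope simple.
\<close>

locale simple_system =
  fixes n :: nat and I :: "'i set" and a :: "'i \<Rightarrow> rvec" and b :: "'i \<Rightarrow> real" and P :: "rvec set"
  assumes P_eq: "P = {x \<in> Rn n. \<forall>i\<in>I. dotp (a i) x \<le> b i}"
    and finite_I: "finite I"
    and coord_bounded: "\<exists>B. \<forall>x\<in>P. \<forall>k<n. \<bar>coord x k\<bar> \<le> B"
    and nonempty: "P \<noteq> {}"
    and row_tight: "i \<in> I \<Longrightarrow> \<exists>x\<in>P. dotp (a i) x = b i"
    and dual_vector: "x \<in> P \<Longrightarrow> i \<in> I \<Longrightarrow> dotp (a i) x = b i \<Longrightarrow>
      \<exists>d\<in>Rn n. dotp (a i) d \<noteq> 0 \<and> (\<forall>j\<in>I - {i}. dotp (a j) x = b j \<longrightarrow> dotp (a j) d = 0)"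
begin

definition tight :: "rvec \<Rightarrow> 'i set" where
  "tight x = {i \<in> I. dotp (a i) x = b i}"

definition ker :: "'i set \<Rightarrow> rvec set" where
  "ker A = {d \<in> Rn n. \<forall>i\<in>A. dotp (a i) d = 0}"

definition slice :: "'i set \<Rightarrow> rvec set" where
  "slice A = {x \<in> P. A \<subseteq> tight x}"

lemma tight_subset: "tight x \<subseteq> I" and finite_tight [simp]: "finite (tight x)"
  using finite_I by (auto simp: tight_def)

lemma P_Rn: "x \<in> P \<Longrightarrow> x \<in> Rn n" by (simp add: P_eq)

lemma subspace_ker: "subspace (ker A)"
  using subspace_Rn[of n] by (auto simp: ker_def subspace_def)

text \<open>Each tight row lowers the dimension by exactly one: the dual vector of the new row is
  annihilated by the earlier rows but not by its own.\<close>

lemma dim_ker: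
  assumes "x \<in> P" "A \<subseteq> tight x"
  shows "dim (ker A) + card A = n"
proof -
  have "finite A" using assms finite_tight finite_subset by blast
  then show ?thesis using assms(2)
  proof (induction A rule: finite_induct)
    case empty
    then show ?case using dim_Rn[of n] by (simp add: ker_def)
  next
    case (insert i A)
    obtain d where d: "d \<in> Rn n" "dotp (a i) d \<noteq> 0" "\<forall>j\<in>tight x - {i}. dotp (a j) d = 0"
      using dual_vector[OF assms(1), of i] insert.prems by (auto simp: tight_def)
    obtain W where W: "finite W" "Rn n \<subseteq> span W" using dim_Rn by blast
    have "ker (insert i A) = {y \<in> ker A. dotp (a i) y = 0}" by (auto simp: ker_def)
    moreover have "dim (ker A) = Suc (dim {y \<in> ker A. dotp (a i) y = 0})"
      by (rule dim_kernel[OF subspace_ker linear_dotp, of d])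
        (use d W insert in \<open>auto simp: ker_def\<close>)
    ultimately show ?case using insert by simp
  qed
qed

lemma card_tight_le: "x \<in> P \<Longrightarrow> card (tight x) \<le> n"
  using dim_ker[of x "tight x"] by simp

text \<open>\<open>dim\<close> is the \<open>card\<close> of a basis, hence 0 also for an infinite
  one; the finite spanning set of \<open>Rn n\<close> excludes that case.\<close>

lemma ker_trivial:
  assumes "dim (ker A) = 0" "d \<in> ker A" shows "d = 0"
proof -
  obtain W where W: "finite W" "Rn n \<subseteq> span W" using dim_Rn by blast
  obtain B where B: "B \<subseteq> ker A" "independent B" "ker A \<subseteq> span B" "card B = dim (ker A)"
    by (rule basis_exists)
  moreover have "finite B"
    using independent_span_bound[OF W(1) B(2)] B(1) W(2) by (auto simp: ker_def)
  ultimately show ?thesis using assms by auto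
qed

lemma dual_vector_tight:
  assumes "x \<in> P" "i \<in> tight x"
  obtains d where "d \<in> Rn n" "dotp (a i) d = -1" "\<forall>j\<in>tight x - {i}. dotp (a j) d = 0"
proof -
  obtain d where d: "d \<in> Rn n" "dotp (a i) d \<noteq> 0" "\<forall>j\<in>tight x - {i}. dotp (a j) d = 0"
    using dual_vector[OF assms(1), of i] assms by (auto simp: tight_def)
  show ?thesis
    by (rule that[of "(- 1 / dotp (a i) d) *\<^sub>R d"]) (use d in auto)
qed

lemma small_step:
  assumes x: "x \<in> P" and d: "d \<in> Rn n" "\<forall>i\<in>tight x. dotp (a i) d \<le> 0"
  obtains t where "t > 0" "x + t *\<^sub>R d \<in> P" "tight (x + t *\<^sub>R d) = {i \<in> tight x. dotp (a i) d = 0}"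
proof -
  have "\<forall>\<^sub>F t in at_right 0. \<forall>i\<in>I - tight x. dotp (a i) x + t * dotp (a i) d < b i"
  proof (intro eventually_ball_finite ballI)
    fix i assume i: "i \<in> I - tight x"
    then have "dotp (a i) x + 0 * dotp (a i) d < b i"
      using x by (force simp: P_eq tight_def)
    moreover have "((\<lambda>t. dotp (a i) x + t * dotp (a i) d) \<longlongrightarrow> dotp (a i) x + 0 * dotp (a i) d) (at_right 0)"
      by (intro tendsto_intros)
    ultimately show "\<forall>\<^sub>F t in at_right 0. dotp (a i) x + t * dotp (a i) d < b i"
      by (metis order_tendstoD(2))
  qed (use finite_I in simp)
  moreover have "\<forall>\<^sub>F t :: real in at_right 0. t > 0"
    by (simp add: eventually_at_right_less)
  ultimately have "\<forall>\<^sub>F t in at_right 0. t > 0 \<and> (\<forall>i\<in>I - tight x. dotp (a i) x + t * dotp (a i) d < b i)"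
    by eventually_elim auto
  from eventually_happens'[OF trivial_limit_at_right_real this]
  obtain t where t: "t > 0" "\<And>i. i \<in> I - tight x \<Longrightarrow> dotp (a i) x + t * dotp (a i) d < b i"
    by blast
  have tx: "dotp (a i) x + t * dotp (a i) d \<le> b i" if "i \<in> tight x" for i
    using that d t(1) by (auto simp: tight_def mult_nonneg_nonpos)
  show ?thesis
  proof (rule that[OF t(1)])
    show "x + t *\<^sub>R d \<in> P"
      using x d t tx by (simp add: P_eq) (metis DiffI less_imp_le)
    show "tight (x + t *\<^sub>R d) = {i \<in> tight x. dotp (a i) d = 0}"
      using t by (auto simp: tight_def) force+
  qed
qed

text \<open>Tight rows can be loosened independently of each other: the sum of the dual vectors of
  the rows outside \<open>A\<close> moves away from those rows and along the rows of
  \<open>A\<close>.\<close>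

lemma exists_point_tight:
  assumes x: "x \<in> P" and A: "A \<subseteq> tight x"
  obtains y where "y \<in> P" "tight y = A"
proof -
  define d where "d i = (SOME d. d \<in> Rn n \<and> dotp (a i) d = -1 \<and> (\<forall>j\<in>tight x - {i}. dotp (a j) d = 0))" for i
  have d: "d i \<in> Rn n \<and> dotp (a i) (d i) = -1 \<and> (\<forall>j\<in>tight x - {i}. dotp (a j) (d i) = 0)"
    if "i \<in> tight x" for i
    unfolding d_def by (rule someI_ex) (use dual_vector_tight[OF x that] in blast)
  define e where "e = (\<Sum>i\<in>tight x - A. d i)"
  have e: "e \<in> Rn n"
    unfolding e_def by (rule subspace_sum[OF subspace_Rn]) (use d in auto)
  have dot: "dotp (a j) e = (if j \<in> A then 0 else -1)" if j: "j \<in> tight x" for j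
  proof -
    have "dotp (a j) e = (\<Sum>i\<in>tight x - A. dotp (a j) (d i))"
      unfolding e_def by (simp add: linear_sum[OF linear_dotp])
    also have "\<dots> = (\<Sum>i\<in>tight x - A. if i = j then -1 else 0)"
      by (rule sum.cong) (use d j in auto)
    finally show ?thesis using j by simp
  qed
  obtain t where t: "t > 0" "x + t *\<^sub>R e \<in> P" "tight (x + t *\<^sub>R e) = {i \<in> tight x. dotp (a i) e = 0}"
    by (rule small_step[OF x e]) (simp add: dot)
  moreover have "{i \<in> tight x. dotp (a i) e = 0} = A"
    using A by (auto simp: dot split: if_splits)
  ultimately show ?thesis using that by blast
qed

lemma ray_leaves:
  assumes d: "d \<in> Rn n" "d \<noteq> 0" and x: "x \<in> P"
  shows "\<exists>i\<in>I. dotp (a i) d > 0"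
proof (rule ccontr)
  assume "\<not> ?thesis"
  then have neg: "\<And>i. i \<in> I \<Longrightarrow> dotp (a i) d \<le> 0" by force
  obtain k where k: "k < n" "coord d k \<noteq> 0"
    using rvec_eqI[OF d(1) Rn_0] d(2) by auto
  obtain B where B: "\<And>y. y \<in> P \<Longrightarrow> \<bar>coord y k\<bar> \<le> B"
    using coord_bounded k by blast
  \<comment> \<open>This step moves coordinate \<open>k\<close> by \<open>2 * B + 1\<close>, more
    than the interval from \<open>- B\<close> to \<open>B\<close> admits.\<close>
  define t where "t = (2 * B + 1) / \<bar>coord d k\<bar>"
  have t: "t \<ge> 0" using B[OF x] by (simp add: t_def)
  have "x + t *\<^sub>R d \<in> P"
    using x d neg t by (auto simp: P_eq intro: order_trans[OF add_mono[OF _ mult_nonneg_nonpos]])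
  then have "\<bar>coord x k + t * coord d k\<bar> \<le> B" using B by (fastforce simp: lookup_add)
  moreover have "\<bar>t * coord d k\<bar> = 2 * B + 1"
    using k t B[OF x] by (simp add: t_def abs_mult)
  ultimately show False using B[OF x] by linarith
qed

text \<open>The ratio test: \<open>t\<close> is the first time at which a row increasing along
  \<open>d\<close> becomes tight, and \<open>ray_leaves\<close> supplies such a row.\<close>

lemma long_step:
  assumes x: "x \<in> P" and d: "d \<in> ker (tight x)" "d \<noteq> 0"
  obtains t where "t > 0" "x + t *\<^sub>R d \<in> P" "tight x \<subset> tight (x + t *\<^sub>R d)"
proof -
  have dR: "d \<in> Rn n" and dk: "\<And>i. i \<in> tight x \<Longrightarrow> dotp (a i) d = 0"
    using d by (auto simp: ker_def)
  define J where "J = {i \<in> I. dotp (a i) d > 0}"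
  define r where "r i = (b i - dotp (a i) x) / dotp (a i) d" for i
  have J: "finite J" "J \<noteq> {}"
    using finite_I ray_leaves[OF dR d(2) x] by (auto simp: J_def)
  have rpos: "r i > 0" if "i \<in> J" for i
  proof -
    have "i \<notin> tight x" using dk that by (force simp: J_def)
    then show ?thesis using that x by (force simp: r_def J_def tight_def P_eq)
  qed
  define t where "t = Min (r ` J)"
  have "t \<in> r ` J"
    unfolding t_def by (rule Min_in) (use J in auto)
  then obtain i0 where i0: "i0 \<in> J" "t = r i0" by blast
  have t: "t > 0" using rpos i0 by simp
  have le: "dotp (a i) x + t * dotp (a i) d \<le> b i" if i: "i \<in> I" for i
  proof (cases "i \<in> J")
    case True
    then have "t \<le> r i" using J by (simp add: t_def)
    then show ?thesis using True by (simp add: r_def J_def field_simps)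
  next
    case False
    then have "t * dotp (a i) d \<le> 0" using i t by (simp add: J_def mult_nonneg_nonpos)
    then show ?thesis using x i by (force simp: P_eq)
  qed
  have "i0 \<in> tight (x + t *\<^sub>R d)" using i0 by (simp add: tight_def r_def J_def)
  moreover have "i0 \<notin> tight x" using i0 dk by (force simp: J_def)
  moreover have "tight x \<subseteq> tight (x + t *\<^sub>R d)"
    using dk by (auto simp: tight_def)
  ultimately show ?thesis using that[OF t] le x dR by (auto simp: P_eq)
qed

section \<open>Faces as slices by tight rows; facets, vertices and simplicity\<close>

lemma convex_P: "convex P"
proof (rule convexI)
  fix x y :: rvec and u v :: real
  assume "x \<in> P" "y \<in> P" "0 \<le> u" "0 \<le> v" "u + v = 1"
  then show "u *\<^sub>R x + v *\<^sub>R y \<in> P"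
    by (auto simp: P_eq intro: convex_bound_le)
qed

text \<open>The slack at an inner point is a combination, with positive weights, of the nonnegative
  slacks at the ends, so it vanishes only if both do.\<close>

lemma tight_open_segment:
  assumes "y \<in> P" "z \<in> P" "x \<in> open_segment y z"
  shows "tight x = tight y \<inter> tight z"
proof -
  obtain u where u: "0 < u" "u < 1" "x = (1 - u) *\<^sub>R y + u *\<^sub>R z"
    using assms(3) by (auto simp: in_segment)
  have "dotp (a i) x = b i \<longleftrightarrow> dotp (a i) y = b i \<and> dotp (a i) z = b i" if i: "i \<in> I" for i
  proof -
    have "dotp (a i) y \<le> b i" "dotp (a i) z \<le> b i" using assms i by (auto simp: P_eq)
    moreover have "dotp (a i) x = (1 - u) * dotp (a i) y + u * dotp (a i) z"
      by (simp add: u(3))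
    then have "b i - dotp (a i) x = (1 - u) * (b i - dotp (a i) y) + u * (b i - dotp (a i) z)"
      by (simp add: algebra_simps)
    ultimately have "b i - dotp (a i) x = 0 \<longleftrightarrow> (1 - u) * (b i - dotp (a i) y) = 0 \<and> u * (b i - dotp (a i) z) = 0"
      using u(1,2) by (simp only: add_nonneg_eq_0_iff mult_nonneg_nonneg diff_ge_0_iff_ge less_imp_le)
    moreover have "1 - u \<noteq> 0" "u \<noteq> 0" using u(1,2) by auto
    ultimately show ?thesis
      by (metis mult_eq_0_iff right_minus_eq)
  qed
  then show ?thesis by (auto simp: tight_def)
qed

lemma slice_face: "slice A face_of P"
  unfolding face_of_def
proof (intro conjI ballI impI)
  show "slice A \<subseteq> P" by (auto simp: slice_def)
  show "convex (slice A)"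
  proof (rule convexI)
    fix x y :: rvec and u v :: real
    assume xy: "x \<in> slice A" "y \<in> slice A" and uv: "0 \<le> u" "0 \<le> v" "u + v = 1"
    then have "u *\<^sub>R x + v *\<^sub>R y \<in> P"
      by (intro convexD[OF convex_P]) (auto simp: slice_def)
    moreover have "dotp (a i) (u *\<^sub>R x + v *\<^sub>R y) = b i" if "i \<in> A" for i
    proof -
      have "dotp (a i) x = b i" "dotp (a i) y = b i" using xy that by (auto simp: slice_def tight_def)
      then show ?thesis using uv by (simp flip: distrib_right)
    qed
    ultimately show "u *\<^sub>R x + v *\<^sub>R y \<in> slice A"
      using xy by (auto simp: slice_def tight_def)
  qed
next
  fix y z x assume "y \<in> P" "z \<in> P" "x \<in> slice A" "x \<in> open_segment y z"
  then have "tight x = tight y \<inter> tight z" "A \<subseteq> tight x"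
    by (auto simp: tight_open_segment slice_def)
  then show "y \<in> slice A" "z \<in> slice A" using \<open>y \<in> P\<close> \<open>z \<in> P\<close> by (auto simp: slice_def)
qed

text \<open>A point at which exactly \<open>A\<close> is tight can be moved a little in every
  direction of \<open>ker A\<close>, so the differences within the slice span
  \<open>ker A\<close>.\<close>

lemma adim_slice:
  assumes x: "x \<in> P" and A: "A \<subseteq> tight x"
  shows "adim (slice A) = int n - int (card A)"
proof -
  let ?D = "{y - z |y z. y \<in> slice A \<and> z \<in> slice A}"
  obtain y where y: "y \<in> P" "tight y = A" using exists_point_tight[OF assms] .
  have "?D \<subseteq> ker A"
    by (auto simp: slice_def ker_def tight_def P_Rn subset_iff)
  moreover have "ker A \<subseteq> span ?D"
  proof
    fix d assume d: "d \<in> ker A"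
    obtain t where t: "t > 0" "y + t *\<^sub>R d \<in> P" "tight (y + t *\<^sub>R d) = {i \<in> tight y. dotp (a i) d = 0}"
      by (rule small_step[OF y(1)]) (use d y in \<open>auto simp: ker_def\<close>)
    have "y + t *\<^sub>R d \<in> slice A" "y \<in> slice A" using t y d by (auto simp: slice_def ker_def)
    then have "(y + t *\<^sub>R d) - y \<in> ?D" by blast
    then have "(1 / t) *\<^sub>R (t *\<^sub>R d) \<in> span ?D" by (intro span_scale span_base) simp
    then show "d \<in> span ?D" using t by simp
  qed
  ultimately have "span ?D = span (ker A)"
    unfolding span_eq using span_superset[of "ker A"] by blast
  then have "dim ?D = dim (ker A)" by (rule span_eq_dim)
  moreover have "slice A \<noteq> {}" using x A by (auto simp: slice_def)
  ultimately show ?thesis using dim_ker[OF assms] by (simp add: adim_def)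
qed

lemma slice_empty: "slice {} = P"
  by (simp add: slice_def)

lemma adim_P: "adim P = int n"
  using nonempty adim_slice[of _ "{}"] by (auto simp: slice_empty)

text \<open>A point of \<open>F\<close> with the fewest tight rows acts as a relative interior
  point. By taking midpoints, its tight rows are tight on all of \<open>F\<close>; conversely, a
  segment from any point of the slice can be prolonged beyond it inside \<open>P\<close>, and the
  face property applies.\<close>

lemma face_eq_slice:
  assumes F: "F face_of P" "F \<noteq> {}"
  obtains x where "x \<in> P" "F = slice (tight x)"
proof -
  have FP: "F \<subseteq> P" using F face_of_imp_subset by blast
  obtain x0 where "x0 \<in> F" using F(2) by blast
  from arg_min_nat_lemma[of "\<lambda>x. x \<in> F" _ "\<lambda>x. card (tight x)", OF this]
  obtain x where x: "x \<in> F" and min: "\<And>y. y \<in> F \<Longrightarrow> card (tight x) \<le> card (tight y)"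
    by blast
  have "y \<in> slice (tight x)" if y: "y \<in> F" for y
  proof (cases "y = x")
    case False
    then have m: "midpoint x y \<in> open_segment x y" by simp
    then have "midpoint x y \<in> F"
      using face_of_imp_convex[OF F(1)] x y
      by (meson convex_contains_open_segment subsetD)
    moreover have "tight (midpoint x y) = tight x \<inter> tight y"
      by (rule tight_open_segment[OF _ _ m]) (use x y FP in auto)
    ultimately have "card (tight x) \<le> card (tight x \<inter> tight y)"
      using min by metis
    then have "tight x \<inter> tight y = tight x"
      by (intro card_seteq) auto
    then show ?thesis using y FP by (auto simp: slice_def)
  qed (use x FP in \<open>auto simp: slice_def\<close>)
  moreover have "y \<in> F" if y: "y \<in> slice (tight x)" for y
  proof (cases "y = x")
    case False
    have yP: "y \<in> P" "tight x \<subseteq> tight y" using y by (auto simp: slice_def)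
    have d: "x - y \<in> ker (tight x)"
      using yP x FP by (auto simp: ker_def P_Rn tight_def subset_eq)
    obtain t where t: "t > 0" "x + t *\<^sub>R (x - y) \<in> P"
      by (rule small_step[of x "x - y"]) (use d x FP in \<open>auto simp: ker_def\<close>)
    \<comment> \<open>The position of \<open>x\<close> on the segment from \<open>y\<close> to the
      point reached by continuing past \<open>x\<close>.\<close>
    define u where "u = 1 / (1 + t)"
    have u: "0 < u" "u < 1" and ut: "u + u * t = 1"
      using t(1) by (auto simp: u_def field_simps)
    have "(1 - u) *\<^sub>R y + u *\<^sub>R (x + t *\<^sub>R (x - y)) = (u + u * t) *\<^sub>R x + (1 - (u + u * t)) *\<^sub>R y"
      by (simp add: algebra_simps)
    then have "x = (1 - u) *\<^sub>R y + u *\<^sub>R (x + t *\<^sub>R (x - y))"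
      by (simp add: ut)
    moreover have "y \<noteq> x + t *\<^sub>R (x - y)"
    proof
      assume "y = x + t *\<^sub>R (x - y)"
      then have "(1 + t) *\<^sub>R (x - y) = 0" by (simp add: algebra_simps)
      with t False show False by simp
    qed
    ultimately have "x \<in> open_segment y (x + t *\<^sub>R (x - y))"
      using u unfolding in_segment by blast
    then show ?thesis using F(1) x yP t unfolding face_of_def by blast
  qed (use x in simp)
  ultimately show ?thesis using that[of x] x FP by blast
qed

text \<open>All other rows can be loosened at a point where row \<open>i\<close> is tight. This is
  why each row gives a facet and different rows give different facets.\<close>

lemma row_tight_alone:
  assumes "i \<in> I" obtains x where "x \<in> P" "tight x = {i}"
proof -
  obtain y where "y \<in> P" "dotp (a i) y = b i" using row_tight[OF assms] by blast
  then show ?thesis using that assms exists_point_tight[of y "{i}"] by (auto simp: tight_def)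
qed

lemma facet_iff: "facet P F \<longleftrightarrow> (\<exists>i\<in>I. F = slice {i})"
proof
  assume F: "facet P F"
  then have "F face_of P" "F \<noteq> {}" by (simp_all add: facet_def)
  then obtain x where x: "x \<in> P" "F = slice (tight x)" by (rule face_eq_slice)
  then have "card (tight x) = 1"
    using F adim_slice[OF x(1) subset_refl] by (simp add: facet_def adim_P)
  then obtain i where i: "tight x = {i}" by (rule card_1_singletonE)
  then have "i \<in> I" using tight_subset[of x] by simp
  then show "\<exists>i\<in>I. F = slice {i}" using x(2) i by (intro bexI[of _ i]) simp_all
next
  assume "\<exists>i\<in>I. F = slice {i}"
  then obtain i where i: "i \<in> I" "F = slice {i}" by blast
  obtain x where x: "x \<in> P" "tight x = {i}" using row_tight_alone[OF i(1)] .
  moreover have "x \<in> slice {i}" using x by (simp add: slice_def)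
  ultimately show "facet P F"
    using i slice_face[of "{i}"] adim_slice[of x "{i}"] unfolding facet_def adim_P by auto
qed

lemma inj_on_slice: "inj_on (\<lambda>i. slice {i}) I"
proof (rule inj_onI)
  fix i j assume ij: "i \<in> I" "j \<in> I" "slice {i} = slice {j}"
  obtain x where x: "x \<in> P" "tight x = {i}" using row_tight_alone[OF ij(1)] .
  then have "x \<in> slice {j}" unfolding ij(3)[symmetric] by (simp add: slice_def)
  then show "i = j" by (simp add: slice_def x)
qed

lemma card_facets: "card {F. facet P F} = card I"
proof -
  have "{F. facet P F} = (\<lambda>i. slice {i}) ` I" by (auto simp: facet_iff)
  then show ?thesis by (simp add: card_image inj_on_slice)
qed

lemma card_facets_at:
  assumes "x \<in> P" shows "card {F. facet P F \<and> x \<in> F} = card (tight x)"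
proof -
  have "{F. facet P F \<and> x \<in> F} = (\<lambda>i. slice {i}) ` tight x"
  proof (intro set_eqI iffI)
    fix F assume "F \<in> {F. facet P F \<and> x \<in> F}"
    then obtain i where i: "F = slice {i}" "x \<in> slice {i}" by (auto simp only: facet_iff mem_Collect_eq)
    then show "F \<in> (\<lambda>i. slice {i}) ` tight x" by (auto simp: slice_def)
  next
    fix F assume "F \<in> (\<lambda>i. slice {i}) ` tight x"
    then obtain i where i: "F = slice {i}" "i \<in> tight x" by blast
    moreover have "i \<in> I" using i(2) by (simp add: tight_def)
    moreover have "x \<in> slice {i}" using assms i(2) by (simp add: slice_def)
    ultimately show "F \<in> {F. facet P F \<and> x \<in> F}" unfolding facet_iff by blast
  qed
  then show ?thesis
    by (simp add: card_image inj_on_subset[OF inj_on_slice tight_subset])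
qed

text \<open>A nonzero direction in the kernel of the tight rows could be followed both ways and put
  \<open>x\<close> inside a segment. Conversely, the ends of a segment through \<open>x\<close>
  share the tight rows of \<open>x\<close>, and \<open>n\<close> of these leave only the kernel
  0.\<close>

lemma extreme_point_iff: "x extreme_point_of P \<longleftrightarrow> x \<in> P \<and> card (tight x) = n"
proof
  assume x: "x extreme_point_of P"
  then have xP: "x \<in> P" by (simp add: extreme_point_of_def)
  have "ker (tight x) \<subseteq> {0}"
  proof
    fix d assume d: "d \<in> ker (tight x)"
    show "d \<in> {0}"
    proof (rule ccontr)
      assume "d \<notin> {0}"
      then have d0: "d \<noteq> 0" by simp
      have d': "- d \<in> ker (tight x)" using subspace_neg[OF subspace_ker d] .
      obtain s where s: "s > 0" "x + s *\<^sub>R d \<in> P" using long_step[OF xP d d0] by blast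
      obtain t where t: "t > 0" "x + t *\<^sub>R - d \<in> P" using long_step[OF xP d'] d0 by auto
      have "x \<in> open_segment (x + s *\<^sub>R d) (x + t *\<^sub>R - d)"
        using segment_through[OF s(1) t(1) d0] by simp
      then show False using x s t by (auto simp: extreme_point_of_def)
    qed
  qed
  then have "dim (ker (tight x)) = 0"
    using dim_le_card[of "ker (tight x)" "{}"] by simp
  then show "x \<in> P \<and> card (tight x) = n" using dim_ker[OF xP subset_refl] xP by simp
next
  assume x: "x \<in> P \<and> card (tight x) = n"
  then have 0: "dim (ker (tight x)) = 0" using dim_ker[of x "tight x"] by simp
  show "x extreme_point_of P"
    unfolding extreme_point_of_def
  proof (intro conjI ballI notI)
    fix y z assume y: "y \<in> P" and z: "z \<in> P" and seg: "x \<in> open_segment y z"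
    then have "tight x = tight y \<inter> tight z" using tight_open_segment by blast
    then have "y - z \<in> ker (tight x)" using y z by (auto simp: ker_def P_Rn tight_def)
    from ker_trivial[OF 0 this] show False using seg by simp
  qed (use x in simp)
qed

lemma polytope_P: "polytope P"
proof -
  define V where "V = {x. x extreme_point_of P}"
  have "inj_on tight V"
  proof (rule inj_onI)
    fix x y assume xy: "x \<in> V" "y \<in> V" "tight x = tight y"
    then have "dim (ker (tight x)) = 0"
      using dim_ker[of x "tight x"] by (simp add: V_def extreme_point_iff)
    moreover have "dotp (a i) x = b i \<and> dotp (a i) y = b i" if "i \<in> tight x" for i
      using that xy(3) by (metis (mono_tags, lifting) mem_Collect_eq tight_def)
    then have "x - y \<in> ker (tight x)"
      using xy by (auto simp: V_def extreme_point_iff ker_def P_Rn)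
    ultimately show "x = y" using ker_trivial[of "tight x" "x - y"] by simp
  qed
  moreover have "tight ` V \<subseteq> Pow I" by (auto simp: tight_def)
  ultimately have finV: "finite V"
    using finite_I by (meson finite_Pow_iff finite_imageD finite_subset)
  have "x \<in> convex hull V" if "x \<in> P" for x
    using that
  \<comment> \<open>A point that is not a vertex lies between two points reached along
    \<open>d\<close> and \<open>- d\<close>, each with strictly more tight rows.\<close>
  proof (induction "n - card (tight x)" arbitrary: x rule: less_induct)
    case less
    show ?case
    proof (cases "card (tight x) = n")
      case True
      then show ?thesis using less.prems by (simp add: V_def extreme_point_iff hull_inc)
    next
      case False
      then have lt: "card (tight x) < n" using card_tight_le[OF less.prems] by simp
      have "\<not> ker (tight x) \<subseteq> {0}"
        using dim_le_card[of "ker (tight x)" "{}"] dim_ker[OF less.prems subset_refl] lt by auto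
      then obtain d where d: "d \<in> ker (tight x)" "d \<noteq> 0" by auto
      have d': "- d \<in> ker (tight x)" using subspace_neg[OF subspace_ker d(1)] .
      obtain s where s: "s > 0" "x + s *\<^sub>R d \<in> P" "tight x \<subset> tight (x + s *\<^sub>R d)"
        using long_step[OF less.prems d] by blast
      obtain t where t: "t > 0" "x + t *\<^sub>R - d \<in> P" "tight x \<subset> tight (x + t *\<^sub>R - d)"
        using long_step[OF less.prems d'] d by auto
      have hull: "y \<in> convex hull V" if "y \<in> P" "tight x \<subset> tight y" for y
        using less.hyps[OF _ that(1)] psubset_card_mono[OF _ that(2)] lt by force
      have "x \<in> closed_segment (x + s *\<^sub>R d) (x + t *\<^sub>R - d)"
        using segment_through[OF s(1) t(1) d(2)] by (auto simp: open_segment_def)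
      then show ?thesis
        using closed_segment_subset[OF hull[OF s(2,3)] hull[OF t(2,3)] convex_convex_hull] by blast
    qed
  qed
  moreover have "convex hull V \<subseteq> P"
    by (rule hull_minimal) (auto simp: V_def extreme_point_of_def convex_P)
  ultimately show ?thesis using finV unfolding polytope_def by blast
qed

lemma simple_polytope_P: "simple_polytope P"
  using polytope_P by (simp add: simple_polytope_def card_facets_at extreme_point_iff adim_P)

end

subsection \<open>A Klee-Minty cube with one vertex cut off\<close>

text \<open>
  The rows are \<open>s\<^sub>k \<ge> 0\<close>, the Klee-Minty bounds \<open>s\<^sub>k + 2 \<Sum>\<^bsub>j<k\<^esub> s\<^sub>j \<le> 5 \<cdot> 3\<^sup>k\<close>, and the cuts
  \<open>\<Sum>\<^sub>i s\<^sub>i - \<epsilon> s\<^sub>k \<ge> 1\<close>, which remove the vertex 0 and create a new vertex at which all of them are tight.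
\<close>

datatype row = Lo nat | Up nat | Cut nat

text \<open>
  Within the normal cone of the apex the objective at parameter \<open>t \<le> 2\<^bsup>n+1\<^esup>\<close> varies by at most \<open>2 \<epsilon> t\<close> in
  each coordinate, and solving for the multipliers enlarges this by at most \<open>3\<^sup>n\<close>. With this \<open>\<epsilon>\<close> they
  change by at most 1.
\<close>

definition eps :: "nat \<Rightarrow> real" where
  "eps n = 1 / (4 * 6 ^ n)"

definition km_bound :: "nat \<Rightarrow> real" where
  "km_bound k = 5 * 3 ^ k"

fun row_coeff :: "nat \<Rightarrow> row \<Rightarrow> nat \<Rightarrow> real" where
  "row_coeff n (Lo k) = (\<lambda>i. if i = k then -1 else 0)"
| "row_coeff n (Up k) = (\<lambda>i. (if i = k then 1 else 0) + (if i < k then 2 else 0))"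
| "row_coeff n (Cut k) = (\<lambda>i. (if i = k then eps n else 0) - 1)"

fun row_bound :: "row \<Rightarrow> real" where
  "row_bound (Lo k) = 0"
| "row_bound (Up k) = km_bound k"
| "row_bound (Cut k) = -1"

definition row_normal :: "nat \<Rightarrow> row \<Rightarrow> rvec" where
  "row_normal n r = rvec_of n (row_coeff n r)"

definition rows :: "nat \<Rightarrow> row set" where
  "rows n = Lo ` {..<n} \<union> Up ` {..<n} \<union> Cut ` {..<n}"

definition cut_cube :: "nat \<Rightarrow> rvec set" where
  "cut_cube n = {x \<in> Rn n. \<forall>r\<in>rows n. dotp (row_normal n r) x \<le> row_bound r}"

lemma eps_pos: "0 < eps n" and eps_le: "eps n \<le> 1 / 4"
  by (simp_all add: eps_def field_simps)

lemma km_bound_Suc: "km_bound (Suc k) = 3 * km_bound k"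
  and km_bound_ge: "5 \<le> km_bound k"
  by (simp_all add: km_bound_def)

lemma finite_rows [simp]: "finite (rows n)"
  by (simp add: rows_def)

lemma card_rows: "card (rows n) = 3 * n"
proof -
  have "card (rows n) = card (Lo ` {..<n}) + card (Up ` {..<n}) + card (Cut ` {..<n})"
    unfolding rows_def by (subst card_Un_disjoint; (subst card_Un_disjoint)?) auto
  also have "\<dots> = 3 * n"
    by (simp add: card_image inj_on_def)
  finally show ?thesis .
qed

lemma in_rows_simps [simp]:
  "Lo k \<in> rows n \<longleftrightarrow> k < n" "Up k \<in> rows n \<longleftrightarrow> k < n" "Cut k \<in> rows n \<longleftrightarrow> k < n"
  by (auto simp: rows_def)

lemma ball_rows: "(\<forall>r\<in>rows n. Q r) \<longleftrightarrow> (\<forall>k<n. Q (Lo k)) \<and> (\<forall>k<n. Q (Up k)) \<and> (\<forall>k<n. Q (Cut k))"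
  by (auto simp: rows_def)

lemma dotp_Lo: "k < n \<Longrightarrow> dotp (row_normal n (Lo k)) x = - coord x k"
  by (simp add: row_normal_def dotp_rvec_of if_distrib[of "\<lambda>a. a * _"] sum.delta cong: if_cong)

lemma dotp_Up:
  assumes "k < n" shows "dotp (row_normal n (Up k)) x = coord x k + 2 * (\<Sum>j<k. coord x j)"
proof -
  have "dotp (row_normal n (Up k)) x
      = (\<Sum>i<n. if i = k then coord x i else 0) + (\<Sum>i<n. if i \<in> {..<k} then 2 * coord x i else 0)"
    unfolding row_normal_def dotp_rvec_of sum.distrib[symmetric] by (rule sum.cong) auto
  also have "(\<Sum>i<n. if i \<in> {..<k} then 2 * coord x i else 0) = (\<Sum>i\<in>{..<n} \<inter> {..<k}. 2 * coord x i)"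
    by (simp add: sum.inter_restrict)
  also have "{..<n} \<inter> {..<k} = {..<k}" using assms by auto
  finally show ?thesis using assms by (simp add: sum_distrib_left)
qed

lemma dotp_Cut:
  assumes "k < n" shows "dotp (row_normal n (Cut k)) x = eps n * coord x k - (\<Sum>i<n. coord x i)"
proof -
  have "dotp (row_normal n (Cut k)) x = (\<Sum>i<n. (if i = k then eps n * coord x i else 0) - coord x i)"
    by (auto simp: row_normal_def dotp_rvec_of left_diff_distrib intro!: sum.cong)
  then show ?thesis using assms by (simp add: sum_subtractf)
qed

lemmas dotp_rows = dotp_Lo dotp_Up dotp_Cut

lemma cut_cube_iff: "x \<in> cut_cube n \<longleftrightarrow> x \<in> Rn n \<and> (\<forall>k<n. 0 \<le> coord x k) \<and>
    (\<forall>k<n. coord x k + 2 * (\<Sum>j<k. coord x j) \<le> km_bound k) \<and>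
    (\<forall>k<n. 1 + eps n * coord x k \<le> (\<Sum>i<n. coord x i))"
  by (auto simp: cut_cube_def ball_rows dotp_rows algebra_simps)

text \<open>Twice the next sum is at most \<open>2 * km_bound k\<close>, which the growth factor 3
  beats. Strictness means that \<open>Lo k\<close> and \<open>Up k\<close> are never tight
  together.\<close>

lemma km_partial_sum:
  assumes "\<And>k. k < n \<Longrightarrow> 0 \<le> s k" "\<And>k. k < n \<Longrightarrow> s k + 2 * (\<Sum>j<k. s j) \<le> km_bound k"
  shows "k \<le> n \<Longrightarrow> 0 \<le> (\<Sum>j<k. s j) \<and> 2 * (\<Sum>j<k. s j) < km_bound k"
proof (induction k)
  case 0
  then show ?case by (simp add: km_bound_def)
next
  case (Suc k)
  then show ?case using assms[of k] km_bound_ge[of k] by (simp add: km_bound_Suc)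
qed

text \<open>At a tight cut the coordinates sum to at most 4/3, so every Klee-Minty row is at most
  8/3, below the smallest bound 5. Hence no \<open>Up\<close> row is tight together with a
  cut.\<close>

lemma cut_tight_far:
  assumes x: "x \<in> cut_cube n" and i: "i < n" "1 + eps n * coord x i = (\<Sum>i<n. coord x i)"
    and j: "j < n"
  shows "coord x j + 2 * (\<Sum>l<j. coord x l) < km_bound j"
proof -
  have nn: "\<And>k. k < n \<Longrightarrow> 0 \<le> coord x k" using x by (simp add: cut_cube_iff)
  have "coord x i \<le> (\<Sum>i<n. coord x i)"
    by (rule member_le_sum) (use i nn in auto)
  moreover have "eps n * coord x i \<le> 1/4 * coord x i"
    using eps_le nn i by (intro mult_right_mono) auto
  ultimately have "(\<Sum>i<n. coord x i) \<le> 4/3" using i by linarith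
  moreover have "(\<Sum>l<Suc j. coord x l) \<le> (\<Sum>i<n. coord x i)"
    by (rule sum_mono2) (use j nn in auto)
  ultimately show ?thesis using nn[OF j] km_bound_ge[of j] by simp
qed

text \<open>Otherwise the coordinates would sum to exactly 1, and then the cuts leave room for no
  positive coordinate. So \<open>Lo i\<close> and \<open>Cut i\<close> exclude each other.\<close>

lemma cut_tight_pos:
  assumes x: "x \<in> cut_cube n" and i: "i < n" "1 + eps n * coord x i = (\<Sum>i<n. coord x i)"
  shows "coord x i > 0"
proof (rule ccontr)
  assume "\<not> coord x i > 0"
  moreover have "0 \<le> coord x i" using x i by (simp add: cut_cube_iff)
  ultimately have "coord x i = 0" by simp
  then have 1: "(\<Sum>i<n. coord x i) = 1" using i by simp
  have "coord x k \<le> 0" if "k < n" for k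
  proof -
    have "1 + eps n * coord x k \<le> 1" using x that 1 unfolding cut_cube_iff by metis
    then show ?thesis using eps_pos[of n] by (simp add: mult_le_0_iff)
  qed
  then have "(\<Sum>i<n. coord x i) \<le> 0" by (intro sum_nonpos) auto
  with 1 show False by simp
qed

text \<open>
  Rows \<open>k \<in> S\<close> of the triangular system are Klee-Minty rows, the others are coordinates. It yields both
  the vertices of the cube and the dual vectors.
\<close>

fun km_solve :: "nat set \<Rightarrow> (nat \<Rightarrow> real) \<Rightarrow> nat \<Rightarrow> real" where
  "km_solve S e k = e k - (if k \<in> S then 2 * (\<Sum>j<k. km_solve S e j) else 0)"

declare km_solve.simps [simp del]

lemma km_solve_in: "k \<in> S \<Longrightarrow> km_solve S e k + 2 * (\<Sum>j<k. km_solve S e j) = e k"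
  and km_solve_out: "k \<notin> S \<Longrightarrow> km_solve S e k = e k"
  by (simp_all add: km_solve.simps[of S e k])

lemma km_solve_initial: "(\<And>j. j < k \<Longrightarrow> e j = 0) \<Longrightarrow> j < k \<Longrightarrow> km_solve S e j = 0"
  by (induction j rule: less_induct) (simp add: km_solve.simps[of S e])

definition km_vertex :: "nat set \<Rightarrow> nat \<Rightarrow> real" where
  "km_vertex S = km_solve S (\<lambda>k. if k \<in> S then km_bound k else 0)"

lemma km_vertex_in: "k \<in> S \<Longrightarrow> km_vertex S k + 2 * (\<Sum>j<k. km_vertex S j) = km_bound k"
  and km_vertex_out: "k \<notin> S \<Longrightarrow> km_vertex S k = 0"
  by (simp_all add: km_vertex_def km_solve_in km_solve_out)

lemma km_vertex_sum: "0 \<le> (\<Sum>j<k. km_vertex S j) \<and> 2 * (\<Sum>j<k. km_vertex S j) < km_bound k"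
proof (induction k)
  case 0
  then show ?case by (simp add: km_bound_def)
next
  case (Suc k)
  then show ?case
    using km_vertex_in[of k S] km_vertex_out[of k S] km_bound_ge[of k]
    by (cases "k \<in> S") (simp_all add: km_bound_Suc)
qed

lemma km_vertex_pos: "k \<in> S \<Longrightarrow> 0 < km_vertex S k"
  using km_vertex_in[of k S] km_vertex_sum[where k = k and S = S] by linarith

lemma km_vertex_nonneg: "0 \<le> km_vertex S k"
  using km_vertex_pos[of k S] km_vertex_out[of k S] by (cases "k \<in> S") auto

lemma km_vertex_le: "km_vertex S k + 2 * (\<Sum>j<k. km_vertex S j) \<le> km_bound k"
  using km_vertex_in[of k S] km_vertex_out[of k S] km_vertex_sum[where k = k and S = S]
  by (cases "k \<in> S") auto

text \<open>All coordinates before the least element of \<open>S\<close> vanish, so this coordinate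
  attains its full bound, at least 5. That puts the vertex beyond the cuts and apart from the new
  vertices.\<close>

lemma km_vertex_Least:
  assumes "k \<in> S" shows "km_vertex S (LEAST k. k \<in> S) = km_bound (LEAST k. k \<in> S)"
proof -
  have "(\<Sum>j<(LEAST k. k \<in> S). km_vertex S j) = 0"
    by (rule sum.neutral) (auto simp: km_vertex_out dest: not_less_Least)
  then show ?thesis using km_vertex_in[OF LeastI[of "\<lambda>k. k \<in> S", OF assms]] by simp
qed

lemma km_vertex_in_cut_cube:
  assumes S: "S \<subseteq> {..<n}" "S \<noteq> {}" shows "rvec_of n (km_vertex S) \<in> cut_cube n"
proof -
  let ?m = "LEAST k. k \<in> S"
  obtain k where k: "k \<in> S" using S by blast
  have m: "?m \<in> S" "?m < n"
    using LeastI[of "\<lambda>k. k \<in> S", OF k] S by auto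
  have le: "km_vertex S k \<le> (\<Sum>i<n. km_vertex S i)" if "k < n" for k
    by (rule member_le_sum) (use that km_vertex_nonneg in auto)
  have 5: "5 \<le> (\<Sum>i<n. km_vertex S i)"
    using le[OF m(2)] km_vertex_Least[OF k] km_bound_ge[of ?m] by simp
  have "1 + eps n * km_vertex S k \<le> (\<Sum>i<n. km_vertex S i)" if "k < n" for k
  proof -
    have "eps n * km_vertex S k \<le> 1/4 * km_vertex S k"
      using eps_le km_vertex_nonneg by (intro mult_right_mono) auto
    then show ?thesis using le[OF that] 5 by linarith
  qed
  moreover have "(\<Sum>j<k. coord (rvec_of n (km_vertex S)) j) = (\<Sum>j<k. km_vertex S j)" if "k \<le> n" for k
    by (rule sum.cong) (use that in auto)
  ultimately show ?thesis
    by (simp add: cut_cube_iff km_vertex_nonneg km_vertex_le)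
qed

text \<open>The common solution of the \<open>n\<close> cut equations: by symmetry all coordinates
  equal some \<open>t\<close> with \<open>n * t - eps n * t = 1\<close>.\<close>

definition apex :: "nat \<Rightarrow> rvec" where
  "apex n = rvec_of n (\<lambda>i. 1 / (real n - eps n))"

lemma apex_coord_bounds: "2 \<le> n \<Longrightarrow> 0 < 1 / (real n - eps n) \<and> 1 / (real n - eps n) \<le> 1"
  using eps_le[of n] by (simp add: field_simps)

lemma apex_tight: "2 \<le> n \<Longrightarrow> k < n \<Longrightarrow> dotp (row_normal n (Cut k)) (apex n) = -1"
  using eps_le[of n] by (simp add: dotp_Cut apex_def diff_divide_distrib[symmetric] divide_eq_eq)

lemma odd_le_power3: "1 + 2 * real k \<le> 3 ^ k"
  by (induction k) simp_all

lemma apex_in_cut_cube: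
  assumes n: "2 \<le> n" shows "apex n \<in> cut_cube n"
  unfolding cut_cube_def ball_rows mem_Collect_eq
proof (intro conjI allI impI)
  show "apex n \<in> Rn n" by (simp add: apex_def)
  fix k assume k: "k < n"
  let ?t = "1 / (real n - eps n)"
  have t: "0 < ?t" "?t \<le> 1" using apex_coord_bounds[OF n] by auto
  show "dotp (row_normal n (Lo k)) (apex n) \<le> row_bound (Lo k)"
    using t k by (simp add: dotp_Lo apex_def)
  have "dotp (row_normal n (Up k)) (apex n) = ?t * (1 + 2 * real k)"
    using k by (simp add: dotp_Up apex_def algebra_simps)
  also have "\<dots> \<le> 1 * 3 ^ k"
    using t odd_le_power3[of k] by (intro mult_mono) auto
  also have "\<dots> \<le> row_bound (Up k)" by (simp add: km_bound_def)
  finally show "dotp (row_normal n (Up k)) (apex n) \<le> row_bound (Up k)" .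
  show "dotp (row_normal n (Cut k)) (apex n) \<le> row_bound (Cut k)"
    using apex_tight[OF n k] by simp
qed

text \<open>
  The point in which the cuts meet the edge of the Klee-Minty cube from 0 along the first axis. It is
  the vertex through which every shadow path leaves the removed corner.
\<close>

definition near_origin :: "nat \<Rightarrow> rvec" where
  "near_origin n = rvec_of n (\<lambda>i. if i = 0 then 1 / (1 - eps n) else 0)"

lemma near_origin_sum: "0 < k \<Longrightarrow> k \<le> n \<Longrightarrow> (\<Sum>i<k. coord (near_origin n) i) = 1 / (1 - eps n)"
  by (subst sum.cong[OF refl, of _ _ "\<lambda>i. if i = 0 then 1 / (1 - eps n) else 0"])
    (auto simp: near_origin_def)

lemma near_origin_in_cut_cube:
  assumes n: "2 \<le> n" shows "near_origin n \<in> cut_cube n"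
proof -
  let ?t = "1 / (1 - eps n)"
  have t: "1 \<le> ?t" "?t \<le> 2" "1 + eps n * ?t = ?t"
    using eps_le[of n] eps_pos[of n] by (auto simp: field_simps)
  have c: "coord (near_origin n) k = (if k = 0 then ?t else 0)" if "k < n" for k
    using that by (simp add: near_origin_def)
  have "coord (near_origin n) k + 2 * (\<Sum>i<k. coord (near_origin n) i) \<le> km_bound k" if "k < n" for k
    using that c[OF that] near_origin_sum[of k n] t km_bound_ge[of k] by (cases "k = 0") auto
  moreover have "1 + eps n * coord (near_origin n) k \<le> (\<Sum>i<n. coord (near_origin n) i)" if "k < n" for k
    using that c[OF that] near_origin_sum[of n n] t n by (cases "k = 0") auto
  ultimately show ?thesis
    using c t eps_le[of n] by (simp add: cut_cube_iff) (simp add: near_origin_def)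
qed

text \<open>For \<open>dual_vector\<close> there are two regimes. If no cut is tight, the tight rows
  belong to the Klee-Minty cube and form a triangular system. If some cut is tight, no
  \<open>Up\<close> row is, and for each index at most one of \<open>Lo\<close> and
  \<open>Cut\<close> is.\<close>

lemma simple_system_cut_cube:
  assumes n: "2 \<le> n"
  shows "simple_system n (rows n) (row_normal n) row_bound (cut_cube n)"
proof
  show "cut_cube n = {x \<in> Rn n. \<forall>r\<in>rows n. dotp (row_normal n r) x \<le> row_bound r}"
    by (rule cut_cube_def)
  show "finite (rows n)" by simp
  show "cut_cube n \<noteq> {}" using apex_in_cut_cube[OF n] by auto
  have "\<bar>coord x k\<bar> \<le> km_bound n" if x: "x \<in> cut_cube n" and k: "k < n" for x k
  proof -
    have nn: "\<And>k. k < n \<Longrightarrow> 0 \<le> coord x k" using x by (simp add: cut_cube_iff)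
    have "2 * (\<Sum>i<n. coord x i) < km_bound n"
      using km_partial_sum[of n "coord x" n] x by (simp add: cut_cube_iff)
    moreover have "coord x k \<le> (\<Sum>i<n. coord x i)"
      by (rule member_le_sum) (use k nn in auto)
    ultimately show ?thesis using nn[OF k] by simp
  qed
  then show "\<exists>B. \<forall>x\<in>cut_cube n. \<forall>k<n. \<bar>coord x k\<bar> \<le> B" by blast
next
  fix r assume r: "r \<in> rows n"
  have km: "dotp (row_normal n (Lo k)) (rvec_of n (km_vertex S)) = - km_vertex S k"
    "dotp (row_normal n (Up k)) (rvec_of n (km_vertex S)) = km_vertex S k + 2 * (\<Sum>j<k. km_vertex S j)"
    if "k < n" for k S
    using that by (auto simp: dotp_Lo dotp_Up intro!: sum.cong)
  show "\<exists>x\<in>cut_cube n. dotp (row_normal n r) x = row_bound r"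
  proof (cases r)
    case (Lo k)
    \<comment> \<open>A vertex on which coordinate \<open>k\<close> vanishes, other than the removed
      0, takes a second index; this is where \<open>2 \<le> n\<close> enters.\<close>
    define j where "j = (if k = 0 then 1 else 0 :: nat)"
    have j: "j < n" "j \<noteq> k" using n by (auto simp: j_def)
    show ?thesis
      by (rule bexI[of _ "rvec_of n (km_vertex {j})"])
        (use j Lo r km[of k "{j}"] km_vertex_in_cut_cube[of "{j}" n] in \<open>auto simp: km_vertex_out\<close>)
  next
    case (Up k)
    show ?thesis
      by (rule bexI[of _ "rvec_of n (km_vertex {k})"])
        (use Up r km[of k "{k}"] km_vertex_in[of k "{k}"] km_vertex_in_cut_cube[of "{k}" n] in auto)
  next
    case (Cut k)
    then show ?thesis using apex_in_cut_cube[OF n] apex_tight[OF n] r by auto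
  qed
next
  fix x r assume x: "x \<in> cut_cube n" and r: "r \<in> rows n" and tight: "dotp (row_normal n r) x = row_bound r"
  have nn: "\<And>k. k < n \<Longrightarrow> 0 \<le> coord x k" using x by (simp add: cut_cube_iff)
  define T where "T = {i. i < n \<and> dotp (row_normal n (Cut i)) x = -1}"
  have T: "1 + eps n * coord x i = (\<Sum>i<n. coord x i)" "i < n" if "i \<in> T" for i
    using that by (auto simp: T_def dotp_Cut)
  show "\<exists>d\<in>Rn n. dotp (row_normal n r) d \<noteq> 0 \<and>
      (\<forall>q\<in>rows n - {r}. dotp (row_normal n q) x = row_bound q \<longrightarrow> dotp (row_normal n q) d = 0)"
  proof (cases "T = {}")
    case True
    then have noCut: "dotp (row_normal n (Cut i)) x \<noteq> -1" if "i < n" for i using that by (auto simp: T_def)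
    define S where "S = {k. k < n \<and> dotp (row_normal n (Up k)) x = km_bound k}"
    have S: "coord x k > 0" if "k \<in> S" for k
      using that km_partial_sum[of n "coord x" k] x by (auto simp: S_def dotp_Up cut_cube_iff)
    obtain k where k: "k < n" "r = Lo k \<or> r = Up k"
      using r tight noCut by (cases r) auto
    \<comment> \<open>With this unit right-hand side the solution vanishes before \<open>k\<close>
      and is 1 at \<open>k\<close>, so \<open>r\<close> takes the value 1 or -1 on it, and the other
      tight rows take 0.\<close>
    define e where "e j = (if j = k then 1 else 0 :: real)" for j
    define f where "f = km_solve S e"
    have f0: "f j = 0" if "j < k" for j
      unfolding f_def by (rule km_solve_initial[of k]) (use that in \<open>auto simp: e_def\<close>)
    then have fk: "f k = 1"
      using km_solve_in[of k S e] km_solve_out[of k S e] unfolding f_def[symmetric]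
      by (cases "k \<in> S") (auto simp: e_def)
    have dot: "dotp (row_normal n (Lo j)) (rvec_of n f) = - f j"
      "dotp (row_normal n (Up j)) (rvec_of n f) = f j + 2 * (\<Sum>i<j. f i)" if "j < n" for j
      using that by (auto simp: dotp_Lo dotp_Up intro!: sum.cong)
    show ?thesis
    proof (intro bexI[of _ "rvec_of n f"] conjI ballI impI)
      show "dotp (row_normal n r) (rvec_of n f) \<noteq> 0"
        using k dot[of k] fk f0 by auto
      fix q assume q: "q \<in> rows n - {r}" "dotp (row_normal n q) x = row_bound q"
      show "dotp (row_normal n q) (rvec_of n f) = 0"
      proof (cases q)
        case (Lo j)
        then have j: "j < n" "coord x j = 0" using q by (auto simp: dotp_Lo)
        then have "j \<notin> S" using S by force
        moreover have "j \<noteq> k"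
        proof
          assume "j = k"
          with q k Lo have "r = Up k" by auto
          with tight k have "k \<in> S" by (auto simp: S_def)
          with \<open>j \<notin> S\<close> \<open>j = k\<close> show False by simp
        qed
        ultimately show ?thesis using Lo j dot by (simp add: f_def km_solve_out e_def)
      next
        case (Up j)
        then have j: "j \<in> S" "j < n" using q by (auto simp: S_def)
        moreover have "j \<noteq> k"
        proof
          assume "j = k"
          with q k Up have "r = Lo k" by auto
          with tight k have "coord x k = 0" by (auto simp: dotp_Lo)
          with S[OF j(1)] \<open>j = k\<close> show False by simp
        qed
        ultimately show ?thesis using Up dot km_solve_in[of j S e] by (simp add: f_def e_def)
      next
        case (Cut j)
        then show ?thesis using q noCut by auto
      qed
    qed simp
  next
    case False
    then obtain i where i: "i \<in> T" by blast
    have far: "dotp (row_normal n (Up j)) x \<noteq> km_bound j" if "j < n" for j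
      using cut_tight_far[OF x T(2,1)[OF i] that] that by (simp add: dotp_Up)
    have pos: "coord x j > 0" if "j \<in> T" for j
      using cut_tight_pos[OF x T(2,1)[OF that]] .
    have finT: "finite T" by (simp add: T_def)
    define c where "c = real (card T) - eps n"
    have "card T \<ge> 1" using finT False by (simp add: Suc_le_eq card_gt_0_iff)
    then have c: "c > 0" using eps_le[of n] by (simp add: c_def)
    \<comment> \<open>Chosen so that the coordinates of \<open>f\<close> below sum to
      \<open>eps n * m\<close>. Then \<open>Cut j\<close> vanishes on \<open>f\<close> for every
      \<open>j\<close> in \<open>T\<close> other than \<open>k\<close>, while the extra 1 at
      \<open>k\<close> keeps \<open>r\<close> nonzero.\<close>
    define m where "m = - 1 / c"
    have m: "1 + real (card T) * m = eps n * m" using c by (simp add: m_def c_def field_simps)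
    obtain k where k: "k < n" "r = Lo k \<and> k \<notin> T \<or> r = Cut k \<and> k \<in> T"
    proof (cases r)
      case (Lo k)
      then have "k < n" "coord x k = 0" using r tight by (auto simp: dotp_Lo)
      then show ?thesis using that[of k] Lo pos[of k] by fastforce
    next
      case (Up k)
      then show ?thesis using r tight far by auto
    next
      case (Cut k)
      then show ?thesis using that[of k] r tight by (auto simp: T_def)
    qed
    define f where "f j = (if j = k then 1 else 0) + (if j \<in> T then m else 0)" for j
    have "(\<Sum>j<n. if j \<in> T then m else 0) = (\<Sum>j\<in>{..<n} \<inter> T. m)"
      by (rule sum.inter_restrict[symmetric]) simp
    also have "{..<n} \<inter> T = T" by (auto simp: T_def)
    finally have sum: "(\<Sum>j<n. f j) = eps n * m"
      using k m by (simp add: f_def sum.distrib)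
    have dot: "dotp (row_normal n (Lo j)) (rvec_of n f) = - f j"
      "dotp (row_normal n (Cut j)) (rvec_of n f) = eps n * f j - eps n * m" if "j < n" for j
      using that sum by (auto simp: dotp_Lo dotp_Cut)
    show ?thesis
    proof (intro bexI[of _ "rvec_of n f"] conjI ballI impI)
      show "dotp (row_normal n r) (rvec_of n f) \<noteq> 0"
        using k dot[of k] eps_pos[of n] by (auto simp: f_def algebra_simps)
      fix q assume q: "q \<in> rows n - {r}" "dotp (row_normal n q) x = row_bound q"
      show "dotp (row_normal n q) (rvec_of n f) = 0"
      proof (cases q)
        case (Lo j)
        then have j: "j < n" "coord x j = 0" using q by (auto simp: dotp_Lo)
        then have "j \<notin> T" using pos by force
        moreover have "j \<noteq> k" using q k Lo calculation by auto
        ultimately show ?thesis using Lo j dot by (simp add: f_def)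
      next
        case (Up j)
        then show ?thesis using far q by auto
      next
        case (Cut j)
        then have j: "j \<in> T" "j < n" using q by (auto simp: T_def)
        moreover have "j \<noteq> k" using q k Cut j by auto
        ultimately show ?thesis using Cut dot by (simp add: f_def)
      qed
    qed simp
  qed
qed

subsection \<open>Objectives maximal at a given vertex\<close>

text \<open>
  The objective with multiplier \<open>y\<^sub>k\<close> on the Klee-Minty row \<open>k\<close> if \<open>k \<in> S\<close>, and on the coordinate \<open>s\<^sub>k\<close>
  otherwise. By complementary slackness it is maximal at the vertex of \<open>S\<close> if \<open>y\<close> has the sign pattern \<open>S\<close>.
\<close>

definition slope :: "nat \<Rightarrow> nat set \<Rightarrow> (nat \<Rightarrow> real) \<Rightarrow> nat \<Rightarrow> real" where
  "slope n S y k = y k + 2 * (\<Sum>j<n. if j \<in> S \<and> k < j then y j else 0)"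

lemma slope_Suc: "slope (Suc n) S y k = slope n S y k + (if n \<in> S \<and> k < n then 2 * y n else 0)"
  by (simp add: slope_def)

lemma slope_cong: "(\<And>j. j < n \<Longrightarrow> y j = z j) \<Longrightarrow> k < n \<Longrightarrow> slope n S y k = slope n S z k"
  unfolding slope_def by (intro arg_cong2[of _ _ _ _ "(+)"] arg_cong2[of _ _ _ _ "(*)"] sum.cong) auto

lemma slope_last: "slope (Suc n) S y n = y n"
  by (simp add: slope_def)

lemma slope_add: "slope n S (\<lambda>k. y k + z k) k = slope n S y k + slope n S z k"
proof -
  have "(\<Sum>j<n. if j \<in> S \<and> k < j then y j + z j else 0)
      = (\<Sum>j<n. if j \<in> S \<and> k < j then y j else 0) + (\<Sum>j<n. if j \<in> S \<and> k < j then z j else 0)"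
    unfolding sum.distrib[symmetric] by (rule sum.cong) auto
  then show ?thesis by (simp add: slope_def)
qed

text \<open>Exchanging the sums writes the objective as the combination, with weights
  \<open>y\<close>, of the rows selected by \<open>S\<close>; complementary slackness can then be
  read off term by term.\<close>

lemma slope_sum:
  "(\<Sum>k<n. slope n S y k * s k) = (\<Sum>k<n. y k * s k + (if k \<in> S then 2 * y k * (\<Sum>j<k. s j) else 0))"
proof -
  have inner: "(\<Sum>k<n. (if j \<in> S \<and> k < j then y j else 0) * s k) = (if j \<in> S then y j * (\<Sum>k<j. s k) else 0)"
    if j: "j < n" for j
  proof (cases "j \<in> S")
    case True
    have "(\<Sum>k<n. (if j \<in> S \<and> k < j then y j else 0) * s k) = (\<Sum>k<n. if k \<in> {..<j} then y j * s k else 0)"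
      by (rule sum.cong) (use True in auto)
    also have "\<dots> = (\<Sum>k\<in>{..<n} \<inter> {..<j}. y j * s k)"
      by (rule sum.inter_restrict[symmetric]) simp
    also have "{..<n} \<inter> {..<j} = {..<j}" using j by auto
    finally show ?thesis using True by (simp add: sum_distrib_left)
  qed simp
  have "(\<Sum>k<n. (\<Sum>j<n. if j \<in> S \<and> k < j then y j else 0) * s k)
      = (\<Sum>j<n. \<Sum>k<n. (if j \<in> S \<and> k < j then y j else 0) * s k)"
    unfolding sum_distrib_right by (rule sum.swap)
  also have "\<dots> = (\<Sum>j<n. if j \<in> S then y j * (\<Sum>k<j. s k) else 0)"
    by (rule sum.cong) (use inner in auto)
  finally have "(\<Sum>k<n. slope n S y k * s k)
      = (\<Sum>k<n. y k * s k) + 2 * (\<Sum>k<n. if k \<in> S then y k * (\<Sum>j<k. s j) else 0)"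
    by (simp add: slope_def distrib_right sum.distrib mult.assoc sum_distrib_left[symmetric])
  moreover have "2 * (\<Sum>k<n. if k \<in> S then y k * (\<Sum>j<k. s j) else 0)
      = (\<Sum>k<n. if k \<in> S then 2 * y k * (\<Sum>j<k. s j) else 0)"
    by (subst sum_distrib_left) (rule sum.cong, auto)
  ultimately show ?thesis by (simp add: sum.distrib)
qed

lemma km_vertex_optimal:
  assumes S: "\<And>k. k \<in> S \<Longrightarrow> 0 \<le> y k" "\<And>k. k < n \<Longrightarrow> k \<notin> S \<Longrightarrow> y k \<le> 0"
    and x: "x \<in> cut_cube n"
  shows "(\<Sum>k<n. slope n S y k * coord x k) \<le> (\<Sum>k<n. slope n S y k * km_vertex S k)"
  unfolding slope_sum
proof (rule sum_mono)
  fix k assume "k \<in> {..<n}"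
  then have k: "k < n" by simp
  show "y k * coord x k + (if k \<in> S then 2 * y k * (\<Sum>j<k. coord x j) else 0)
      \<le> y k * km_vertex S k + (if k \<in> S then 2 * y k * (\<Sum>j<k. km_vertex S j) else 0)"
  proof (cases "k \<in> S")
    case True
    have "y k * (coord x k + 2 * (\<Sum>j<k. coord x j)) \<le> y k * (km_vertex S k + 2 * (\<Sum>j<k. km_vertex S j))"
      unfolding km_vertex_in[OF True] using S(1)[OF True] x k by (intro mult_left_mono) (auto simp: cut_cube_iff)
    then show ?thesis using True by (simp add: algebra_simps)
  next
    case False
    have "y k * coord x k \<le> 0"
      using S(2)[OF k False] x k by (intro mult_nonpos_nonneg) (auto simp: cut_cube_iff)
    then show ?thesis using False by (simp add: km_vertex_out)
  qed
qed

text \<open>Back substitution from the last index: removing the contribution of the last unknown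
  changes the earlier right-hand sides by at most \<open>2 * h\<close>, so the bound triples with
  each index.\<close>

lemma solve_slope:
  "(\<And>k. k < n \<Longrightarrow> \<bar>r k\<bar> \<le> h) \<Longrightarrow> 0 \<le> h \<Longrightarrow> \<exists>e. \<forall>k<n. slope n S e k = r k \<and> \<bar>e k\<bar> \<le> 3 ^ n * h"
proof (induction n arbitrary: r h)
  case (Suc n)
  define r' where "r' k = r k - (if n \<in> S then 2 * r n else 0)" for k
  have "\<bar>r' k\<bar> \<le> 3 * h" if "k < n" for k
    using Suc.prems(1)[of k] Suc.prems(1)[of n] that by (auto simp: r'_def)
  then obtain e where e: "\<forall>k<n. slope n S e k = r' k \<and> \<bar>e k\<bar> \<le> 3 ^ n * (3 * h)"
    using Suc.IH[of r' "3 * h"] Suc.prems(2) by auto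
  let ?e = "e(n := r n)"
  have "slope (Suc n) S ?e k = r k \<and> \<bar>?e k\<bar> \<le> 3 ^ Suc n * h" if k: "k < Suc n" for k
  proof (cases "k = n")
    case True
    have "1 * h \<le> 3 ^ Suc n * h" using Suc.prems(2) by (intro mult_right_mono one_le_power) auto
    then show ?thesis using Suc.prems(1)[of n] True by (simp add: slope_last)
  next
    case False
    then have "k < n" using k by simp
    moreover have "slope n S ?e k = slope n S e k" by (rule slope_cong) (use \<open>k < n\<close> in auto)
    ultimately show ?thesis using e[rule_format, of k] by (simp add: slope_Suc r'_def)
  qed
  then show ?case by blast
qed simp

text \<open>
  The multipliers for \<open>w = (-1, \<dots>, -1)\<close>. Along the parametric objective they satisfy
  \<open>|y\<^sub>k\<^sub>+\<^sub>1| = 2\<^bsup>k+1\<^esup> - y\<^sub>k\<close>, so every sign pattern can be prescribed from \<open>k = 0\<close> upwards; the last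
  multiplier then determines the parameter.
\<close>

primrec zigzag :: "nat set \<Rightarrow> nat \<Rightarrow> real" where
  "zigzag S 0 = (if 0 \<in> S then 1 else -1)"
| "zigzag S (Suc k) = (if Suc k \<in> S then 2 ^ Suc k - zigzag S k else zigzag S k - 2 ^ Suc k)"

text \<open>The upper bound keeps \<open>2 ^ Suc k - zigzag S k\<close>, the size of the next
  multiplier, at least 1. This margin absorbs the perturbation of \<open>w\<close>.\<close>

lemma zigzag_abs:
  "\<bar>zigzag S k\<bar> \<le> 2 ^ Suc k - 1 \<and> (k \<in> S \<longrightarrow> 1 \<le> zigzag S k) \<and> (k \<notin> S \<longrightarrow> zigzag S k \<le> -1)"
  by (induction k) auto

text \<open>\<open>S\<close> enters only through the last multiplier: up to a multiple of the
  all-ones vector, every sign pattern yields the same objective.\<close>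

lemma slope_zigzag: "k \<le> m \<Longrightarrow> slope (Suc m) S (zigzag S) k = zigzag S m + 2 ^ Suc m - 2 ^ Suc k"
proof (induction m)
  case (Suc m)
  show ?case
  proof (cases "k = Suc m")
    case False
    then show ?thesis using Suc by (simp add: slope_Suc[of "Suc m"])
  qed (simp add: slope_last)
qed (simp add: slope_last)

text \<open>Consecutive entries differ by \<open>2 ^ Suc k\<close>, which is what produces the
  recursion of \<open>zigzag\<close>; the constant \<open>2 ^ Suc n\<close> makes the parameter
  positive for every sign pattern.\<close>

definition obj :: "nat \<Rightarrow> nat \<Rightarrow> real" where
  "obj n k = 2 ^ Suc n - 2 ^ Suc k"

text \<open>At \<open>t = 2 ^ n - zigzag S m\<close> the unperturbed multipliers are exactly
  \<open>zigzag S\<close>. The term \<open>t * rho k\<close> is answered by a correction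
  \<open>e\<close> with absolute values at most 1, so the signs survive weakly.\<close>

lemma obj_at_parameter:
  assumes n: "0 < n" and rho: "\<And>k. k < n \<Longrightarrow> \<bar>rho k\<bar> \<le> 2 * eps n"
  obtains t y where "0 \<le> t" "\<And>k. k < n \<Longrightarrow> slope n S y k = obj n k - t * (1 - rho k)"
    "\<And>k. k < n \<Longrightarrow> k \<in> S \<Longrightarrow> 0 \<le> y k" "\<And>k. k < n \<Longrightarrow> k \<notin> S \<Longrightarrow> y k \<le> 0"
proof -
  obtain m where m: "n = Suc m" using n by (cases n) auto
  define t where "t = 2 ^ n - zigzag S m"
  have t: "0 \<le> t" "t \<le> 2 * 2 ^ n" using zigzag_abs[of S m] by (auto simp: t_def m)
  have "(6 :: real) ^ n = 2 ^ n * 3 ^ n" using power_mult_distrib[of "2 :: real" 3 n] by simp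
  then have small: "2 * 2 ^ n * (2 * eps n) = 1 / 3 ^ n" by (simp add: eps_def)
  have "\<bar>t * rho k\<bar> \<le> 1 / 3 ^ n" if "k < n" for k
  proof -
    have "\<bar>t * rho k\<bar> \<le> 2 * 2 ^ n * (2 * eps n)"
      unfolding abs_mult using t rho[OF that] by (intro mult_mono) auto
    then show ?thesis by (simp only: small)
  qed
  then obtain e where "\<forall>k<n. slope n S e k = t * rho k \<and> \<bar>e k\<bar> \<le> 3 ^ n * (1 / 3 ^ n)"
    using solve_slope[of n "\<lambda>k. t * rho k" "1 / 3 ^ n" S] by auto
  then have e: "slope n S e k = t * rho k" "\<bar>e k\<bar> \<le> 1" if "k < n" for k using that by auto
  show ?thesis
  proof (rule that[of t "\<lambda>k. zigzag S k + e k"])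
    show "slope n S (\<lambda>k. zigzag S k + e k) k = obj n k - t * (1 - rho k)" if "k < n" for k
      using slope_zigzag[of k m S] e(1)[OF that] that by (simp add: slope_add obj_def t_def m algebra_simps)
    show "0 \<le> zigzag S k + e k" if "k < n" "k \<in> S" for k
      using e(2)[OF that(1)] zigzag_abs[of S k] that by auto
    show "zigzag S k + e k \<le> 0" if "k < n" "k \<notin> S" for k
      using e(2)[OF that(1)] zigzag_abs[of S k] that by auto
  qed (use t in simp)
qed

subsection \<open>The normal cone of the apex is narrow\<close>

lemma apex_tight_Cut:
  assumes n: "2 \<le> n" and r: "r \<in> rows n" "dotp (row_normal n r) (apex n) = row_bound r"
  shows "\<exists>k<n. r = Cut k"
proof (cases r)
  case (Lo k)
  then show ?thesis using r apex_coord_bounds[OF n] by (auto simp: dotp_Lo apex_def)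
next
  case (Up k)
  have "1 + eps n * coord (apex n) 0 = (\<Sum>i<n. coord (apex n) i)"
    using apex_tight[OF n, of 0] n by (simp add: dotp_Cut)
  from cut_tight_far[OF apex_in_cut_cube[OF n] _ this, of k] show ?thesis
    using r Up n by (simp add: dotp_Up)
qed (use r in auto)

text \<open>An objective in the normal cone cannot increase along a feasible direction. The one used
  is the difference of the unit vectors \<open>i\<close> and \<open>j\<close> plus the constant
  \<open>c\<close>, where \<open>c\<close> is chosen so that for distinct \<open>i\<close>,
  \<open>j\<close> the row \<open>Cut i\<close> stays exactly tight.\<close>

lemma normal_cone_apex_spread:
  assumes n: "2 \<le> n" and w: "w \<in> normal_cone n (cut_cube n) (apex n)" and ij: "i < n" "j < n"
  shows "coord w i - coord w j + eps n / (real n - eps n) * (\<Sum>k<n. coord w k) \<le> 0"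
proof -
  interpret simple_system n "rows n" "row_normal n" row_bound "cut_cube n"
    by (rule simple_system_cut_cube[OF n])
  define c where "c = eps n / (real n - eps n)"
  have c: "eps n * (1 + c) = real n * c" "c > 0"
    using n eps_pos[of n] eps_le[of n] by (auto simp: c_def field_simps)
  define f where "f k = (if k = i then 1 else 0) - (if k = j then 1 else 0) + c" for k
  have sum_f: "(\<Sum>k<n. f k) = real n * c"
    using ij by (simp add: f_def sum.distrib sum_subtractf)
  have down: "\<forall>r\<in>tight (apex n). dotp (row_normal n r) (rvec_of n f) \<le> 0"
  proof
    fix r assume "r \<in> tight (apex n)"
    then obtain k where k: "k < n" "r = Cut k" using apex_tight_Cut[OF n, of r] by (auto simp: tight_def)
    have "f k \<le> 1 + c" by (simp add: f_def)
    then have "eps n * f k \<le> real n * c" unfolding c(1)[symmetric] using eps_pos[of n] by (intro mult_left_mono) auto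
    then show "dotp (row_normal n r) (rvec_of n f) \<le> 0" using k sum_f by (simp add: dotp_Cut)
  qed
  obtain t where t: "t > 0" "apex n + t *\<^sub>R rvec_of n f \<in> cut_cube n"
    by (rule small_step[OF apex_in_cut_cube[OF n] rvec_of_in_Rn down])
  then have "dotp w (apex n) \<ge> dotp w (apex n + t *\<^sub>R rvec_of n f)"
    using w t(2) unfolding normal_cone_def by blast
  then have "t * dotp w (rvec_of n f) \<le> 0" by simp
  then have "dotp w (rvec_of n f) \<le> 0" using t(1) by (simp add: mult_le_0_iff)
  also have "dotp w (rvec_of n f) = (\<Sum>k<n. coord w k * f k)"
    using w by (simp add: normal_cone_def dotp_Rn[of w n])
  also have "\<dots> = (\<Sum>k<n. (if k = i then coord w k else 0) - (if k = j then coord w k else 0) + c * coord w k)"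
    by (rule sum.cong) (auto simp: f_def algebra_simps)
  also have "\<dots> = coord w i - coord w j + c * (\<Sum>k<n. coord w k)"
    using ij by (simp add: sum.distrib sum_subtractf sum_distrib_left)
  finally show ?thesis by (simp add: c_def)
qed

text \<open>Averaging the pairwise differences over one index compares \<open>w\<close> with the
  constant vector of the same mean \<open>- om\<close>: relative to \<open>om\<close> the deviation
  is at most \<open>real n * c\<close>.\<close>

lemma normal_cone_apex_narrow:
  assumes n: "2 \<le> n" and w: "w \<in> normal_cone n (cut_cube n) (apex n)" "w \<noteq> 0"
  obtains om rho where "0 < om" "\<And>k. k < n \<Longrightarrow> coord w k = om * (rho k - 1)"
    "\<And>k. k < n \<Longrightarrow> \<bar>rho k\<bar> \<le> 2 * eps n"
proof -
  have wR: "w \<in> Rn n" using w by (simp add: normal_cone_def)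
  define W where "W = - (\<Sum>k<n. coord w k)"
  define c where "c = eps n / (real n - eps n)"
  have c: "c > 0" "real n * c \<le> 2 * eps n"
  proof -
    show "c > 0" using n eps_pos[of n] eps_le[of n] by (simp add: c_def)
    have "real n / (real n - eps n) \<le> 2" using n eps_le[of n] by (simp add: field_simps)
    then have "eps n * (real n / (real n - eps n)) \<le> eps n * 2" using eps_pos[of n] by (intro mult_left_mono) auto
    then show "real n * c \<le> 2 * eps n" by (simp add: c_def mult.commute)
  qed
  have diff: "coord w i - coord w j \<le> c * W" if "i < n" "j < n" for i j
    using normal_cone_apex_spread[OF n w(1) that] by (simp add: W_def c_def)
  have near: "\<bar>real n * coord w k + W\<bar> \<le> real n * (c * W)" if k: "k < n" for k
  proof -
    have eq: "real n * coord w k + W = (\<Sum>j<n. coord w k - coord w j)" by (simp add: W_def sum_subtractf)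
    have "(\<Sum>j<n. coord w k - coord w j) \<le> real (card {..<n}) * (c * W)"
      by (rule sum_bounded_above) (use diff k in auto)
    moreover have "(\<Sum>j<n. coord w j - coord w k) \<le> real (card {..<n}) * (c * W)"
      by (rule sum_bounded_above) (use diff k in auto)
    ultimately show ?thesis unfolding eq by (simp add: sum_subtractf abs_le_iff)
  qed
  have "0 \<le> c * W" using diff[of 0 0] n by simp
  then have "0 \<le> W" using c by (simp add: zero_le_mult_iff)
  moreover have "W \<noteq> 0"
  proof
    assume "W = 0"
    then have "coord w k = 0" if "k < n" for k using near[OF that] n by simp
    then have "w = 0" by (intro rvec_eqI[OF wR Rn_0]) simp
    with w show False by simp
  qed
  ultimately have W: "W > 0" by simp
  define om where "om = W / real n"
  have om: "om > 0" using W n by (simp add: om_def)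
  show ?thesis
  proof (rule that[OF om, of "\<lambda>k. coord w k / om + 1"])
    fix k assume k: "k < n"
    show "coord w k = om * (coord w k / om + 1 - 1)" using om by simp
    have "\<bar>coord w k / om + 1\<bar> = \<bar>real n * coord w k + W\<bar> / W"
      using W n by (simp add: om_def field_simps abs_divide[symmetric])
    also have "\<dots> \<le> real n * (c * W) / W" using near[OF k] W by (intro divide_right_mono) auto
    also have "\<dots> = real n * c" using W by simp
    finally show "\<bar>coord w k / om + 1\<bar> \<le> 2 * eps n" using c by simp
  qed
qed

text \<open>Dividing by \<open>om + t\<close> turns the nonnegative weights into a convex
  combination, with \<open>l = t / (om + t)\<close>.\<close>

lemma maximized_at_convex_combination:
  assumes "w \<in> Rn n" "c \<in> Rn n" "u \<in> P" "0 < om" "0 \<le> t"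
    and max: "\<And>x. x \<in> P \<Longrightarrow> om * dotp c x + t * dotp w x \<le> om * dotp c u + t * dotp w u"
  shows "\<exists>l. 0 \<le> l \<and> l \<le> 1 \<and> maximized_at P (l *\<^sub>R w + (1 - l) *\<^sub>R c) u"
proof -
  have pos: "om + t > 0" using assms by simp
  have l: "1 - t / (om + t) = om / (om + t)" using pos by (simp add: field_simps)
  have "dotp ((t / (om + t)) *\<^sub>R w + (1 - t / (om + t)) *\<^sub>R c) x = (om * dotp c x + t * dotp w x) / (om + t)" for x
    using assms(1,2) unfolding l
    by (simp add: dotp_add_left[of _ n] dotp_scaleR_left[of _ n] add_divide_distrib)
  then have "maximized_at P ((t / (om + t)) *\<^sub>R w + (1 - t / (om + t)) *\<^sub>R c) u"
    using assms(3) max pos by (simp add: maximized_at_def divide_right_mono)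
  then show ?thesis using assms(4,5) by (intro exI[of _ "t / (om + t)"]) simp
qed

subsection \<open>Shadow paths from the apex\<close>

lemma extreme_point_cut_cube:
  assumes n: "2 \<le> n" and x: "x \<in> cut_cube n"
    and q: "inj_on q {..<n}" "\<And>k. k < n \<Longrightarrow> q k \<in> rows n \<and> dotp (row_normal n (q k)) x = row_bound (q k)"
  shows "x extreme_point_of cut_cube n"
proof -
  interpret simple_system n "rows n" "row_normal n" row_bound "cut_cube n"
    by (rule simple_system_cut_cube[OF n])
  have "q ` {..<n} \<subseteq> tight x" using q(2) by (auto simp: tight_def)
  then have "card (q ` {..<n}) \<le> card (tight x)" by (rule card_mono[OF finite_tight])
  then show ?thesis using card_tight_le[OF x] q(1) x by (simp add: card_image extreme_point_iff)
qed

lemma extreme_point_apex: "2 \<le> n \<Longrightarrow> apex n extreme_point_of cut_cube n"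
  by (rule extreme_point_cut_cube[of n _ Cut]) (auto simp: apex_in_cut_cube apex_tight inj_on_def)

lemma extreme_point_near_origin:
  assumes n: "2 \<le> n" shows "near_origin n extreme_point_of cut_cube n"
proof (rule extreme_point_cut_cube[OF n near_origin_in_cut_cube[OF n], of "\<lambda>k. if k = 0 then Cut k else Lo k"])
  fix k assume k: "k < n"
  have "1 - eps n \<noteq> 0" using eps_le[of n] by simp
  then have "eps n * (1 / (1 - eps n)) - 1 / (1 - eps n) = -1"
    by (simp add: diff_divide_distrib[symmetric] divide_eq_eq)
  then show "(if k = 0 then Cut k else Lo k) \<in> rows n \<and>
      dotp (row_normal n (if k = 0 then Cut k else Lo k)) (near_origin n) = row_bound (if k = 0 then Cut k else Lo k)"
    using k near_origin_sum[of n n] by (simp add: dotp_Lo dotp_Cut) (simp add: near_origin_def)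
qed (auto simp: inj_on_def)

lemma extreme_point_km_vertex:
  assumes n: "2 \<le> n" and S: "S \<subseteq> {..<n}" "S \<noteq> {}"
  shows "rvec_of n (km_vertex S) extreme_point_of cut_cube n"
proof (rule extreme_point_cut_cube[OF n km_vertex_in_cut_cube[OF S], of "\<lambda>k. if k \<in> S then Up k else Lo k"])
  fix k assume k: "k < n"
  have "(\<Sum>j<k. if j < n then km_vertex S j else 0) = (\<Sum>j<k. km_vertex S j)"
    by (rule sum.cong) (use k in auto)
  then show "(if k \<in> S then Up k else Lo k) \<in> rows n \<and>
      dotp (row_normal n (if k \<in> S then Up k else Lo k)) (rvec_of n (km_vertex S)) = row_bound (if k \<in> S then Up k else Lo k)"
    using k by (simp add: dotp_Lo dotp_Up km_vertex_in km_vertex_out)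
qed (auto simp: inj_on_def)

lemma maximized_at_cut_cube:
  assumes w: "w \<in> Rn n" "0 < om" "\<And>k. k < n \<Longrightarrow> coord w k = om * (rho k - 1)"
    and u: "u \<in> cut_cube n" and t: "0 \<le> t"
    and max: "\<And>x. x \<in> cut_cube n \<Longrightarrow>
      (\<Sum>k<n. (obj n k - t * (1 - rho k)) * coord x k) \<le> (\<Sum>k<n. (obj n k - t * (1 - rho k)) * coord u k)"
  shows "\<exists>l. 0 \<le> l \<and> l \<le> 1 \<and> maximized_at (cut_cube n) (l *\<^sub>R w + (1 - l) *\<^sub>R rvec_of n (obj n)) u"
proof (rule maximized_at_convex_combination[OF w(1) rvec_of_in_Rn u w(2) t])
  have "om * dotp (rvec_of n (obj n)) x + t * dotp w x = om * (\<Sum>k<n. (obj n k - t * (1 - rho k)) * coord x k)" for x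
  proof -
    have "om * dotp (rvec_of n (obj n)) x + t * dotp w x
        = (\<Sum>k<n. om * (obj n k * coord x k) + t * (coord w k * coord x k))"
      by (simp add: dotp_rvec_of dotp_Rn[OF w(1)] sum_distrib_left sum.distrib)
    also have "\<dots> = (\<Sum>k<n. om * ((obj n k - t * (1 - rho k)) * coord x k))"
      by (rule sum.cong) (simp_all add: w(3) algebra_simps)
    finally show ?thesis by (simp add: sum_distrib_left)
  qed
  then show "om * dotp (rvec_of n (obj n)) x + t * dotp w x
      \<le> om * dotp (rvec_of n (obj n)) u + t * dotp w u" if "x \<in> cut_cube n" for x
    using max[OF that] w(2) by simp
qed

text \<open>At this \<open>t\<close> the coefficient of coordinate 0 vanishes and the others are
  nonpositive, so the whole edge on the first axis is optimal. A maximizer need not be unique to be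
  forced onto the path.\<close>

lemma near_origin_maximizes:
  assumes n: "2 \<le> n" and rho: "\<And>k. k < n \<Longrightarrow> \<bar>rho k\<bar> \<le> 2 * eps n"
  obtains t where "0 \<le> t" "\<And>x. x \<in> cut_cube n \<Longrightarrow> (\<Sum>k<n. (obj n k - t * (1 - rho k)) * coord x k)
    \<le> (\<Sum>k<n. (obj n k - t * (1 - rho k)) * coord (near_origin n) k)"
proof -
  define t where "t = obj n 0 / (1 - rho 0)"
  have r0: "1 - rho 0 > 0" using rho[of 0] eps_le[of n] n by force
  have obj0: "0 \<le> obj n 0" "obj n 0 \<le> 2 * 2 ^ n" by (simp_all add: obj_def)
  have zero: "obj n 0 - t * (1 - rho 0) = 0" using r0 by (simp add: t_def)
  have "(1 :: real) \<le> 3 ^ n" "(6 :: real) ^ n = 2 ^ n * 3 ^ n"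
    using power_mult_distrib[of "2 :: real" 3 n] by simp_all
  then have small: "2 * 2 ^ n * (2 * eps n) \<le> 1" by (simp add: eps_def)
  have neg: "obj n k - t * (1 - rho k) \<le> 0" if k: "k < n" "k \<noteq> 0" for k
  proof -
    have "(2 :: real) ^ Suc 1 \<le> 2 ^ Suc k" using k by (intro power_increasing) auto
    then have gap: "obj n k \<le> obj n 0 - 2" by (simp add: obj_def)
    have objk: "0 \<le> obj n k" using k by (simp add: obj_def power_increasing)
    have "\<bar>obj n k * rho 0\<bar> \<le> 2 * 2 ^ n * (2 * eps n)"
      unfolding abs_mult using rho[of 0] n gap obj0 objk by (intro mult_mono) auto
    moreover have "\<bar>obj n 0 * rho k\<bar> \<le> 2 * 2 ^ n * (2 * eps n)"
      unfolding abs_mult using rho[OF k(1)] obj0 by (intro mult_mono) auto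
    \<comment> \<open>The gap of 2 between the objective entries outweighs the two error terms, each
      at most 1.\<close>
    ultimately have "obj n k * (1 - rho 0) - obj n 0 * (1 - rho k) \<le> 0"
      using gap small by (simp add: algebra_simps abs_le_iff)
    then show ?thesis using r0 by (simp add: t_def field_simps)
  qed
  show ?thesis
  proof (rule that[of t])
    show "0 \<le> t" using obj0 r0 by (simp add: t_def)
    fix x assume x: "x \<in> cut_cube n"
    have "(\<Sum>k<n. (obj n k - t * (1 - rho k)) * coord x k) \<le> 0"
    proof (rule sum_nonpos)
      fix k assume "k \<in> {..<n}"
      then show "(obj n k - t * (1 - rho k)) * coord x k \<le> 0"
        using zero neg[of k] x by (cases "k = 0") (auto simp: cut_cube_iff mult_nonpos_nonneg)
    qed
    also have "0 = (\<Sum>k<n. (obj n k - t * (1 - rho k)) * coord (near_origin n) k)"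
      by (rule sum.neutral[symmetric]) (use zero in \<open>auto simp: near_origin_def\<close>)
    finally show "(\<Sum>k<n. (obj n k - t * (1 - rho k)) * coord x k)
      \<le> (\<Sum>k<n. (obj n k - t * (1 - rho k)) * coord (near_origin n) k)" .
  qed
qed

lemma shadow_path_cut_cube_visits:
  assumes n: "2 \<le> n" and path: "shadow_path n (cut_cube n) (apex n) (rvec_of n (obj n)) w vs"
  shows "insert (apex n) (insert (near_origin n)
    ((\<lambda>S. rvec_of n (km_vertex S)) ` (Pow {..<n} - {{}}))) \<subseteq> set vs"
proof -
  have "w \<in> (top_of_set (Rn n)) interior_of (normal_cone n (cut_cube n) (apex n))"
    using path by (simp add: shadow_path_def)
  then have w: "w \<in> normal_cone n (cut_cube n) (apex n)"
    by (rule subsetD[OF interior_of_subset])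
  then have wR: "w \<in> Rn n" by (simp add: normal_cone_def)
  have "vs \<noteq> []" "hd vs = apex n" using path by (simp_all add: shadow_path_def)
  then have apex: "apex n \<in> set vs" by (metis hd_in_set)
  have visit: "u \<in> set vs" if "u extreme_point_of cut_cube n"
    "\<exists>l. 0 \<le> l \<and> l \<le> 1 \<and> maximized_at (cut_cube n) (l *\<^sub>R w + (1 - l) *\<^sub>R rvec_of n (obj n)) u" for u
  proof -
    have "\<forall>u t. u extreme_point_of cut_cube n \<and> 0 \<le> t \<and> t \<le> 1 \<and>
        maximized_at (cut_cube n) (t *\<^sub>R w + (1 - t) *\<^sub>R rvec_of n (obj n)) u \<longrightarrow> u \<in> set vs"
      using path unfolding shadow_path_def by (elim conjE)
    then show ?thesis using that by blast
  qed
  obtain lam :: "nat \<Rightarrow> real" where lam: "lam 0 = 1" "\<forall>i \<le> path_length vs.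
      uniquely_maximized_at (cut_cube n) (lam i *\<^sub>R w + (1 - lam i) *\<^sub>R rvec_of n (obj n)) (vs ! i)"
    using path unfolding shadow_path_def by (elim conjE exE) (rule that; assumption)
  have "uniquely_maximized_at (cut_cube n) w (vs ! 0)" using lam(1) lam(2)[rule_format, of 0] by simp
  \<comment> \<open>The zero vector would be maximal at every point, against unique maximality at
    parameter 1.\<close>
  have "w \<noteq> 0"
  proof
    assume "w = 0"
    with \<open>uniquely_maximized_at (cut_cube n) w (vs ! 0)\<close>
    have one: "x = vs ! 0" if "x \<in> cut_cube n" for x
      using that by (simp add: uniquely_maximized_at_def maximized_at_def dotp_def)
    have "apex n = near_origin n"
      using one[OF apex_in_cut_cube[OF n]] one[OF near_origin_in_cut_cube[OF n]] by simp
    then have "coord (apex n) 1 = coord (near_origin n) 1" by simp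
    then show False using apex_coord_bounds[OF n] n by (auto simp: apex_def near_origin_def)
  qed
  obtain om rho where om: "0 < om" "\<And>k. k < n \<Longrightarrow> coord w k = om * (rho k - 1)"
    "\<And>k. k < n \<Longrightarrow> \<bar>rho k\<bar> \<le> 2 * eps n"
    using normal_cone_apex_narrow[OF n w \<open>w \<noteq> 0\<close>] by blast
  have near: "near_origin n \<in> set vs"
  proof (rule near_origin_maximizes[OF n om(3)])
    fix t assume t: "0 \<le> t" "\<And>x. x \<in> cut_cube n \<Longrightarrow> (\<Sum>k<n. (obj n k - t * (1 - rho k)) * coord x k)
      \<le> (\<Sum>k<n. (obj n k - t * (1 - rho k)) * coord (near_origin n) k)"
    show ?thesis
      by (rule visit[OF extreme_point_near_origin[OF n]
            maximized_at_cut_cube[OF wR om(1,2) near_origin_in_cut_cube[OF n] t]])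
  qed
  have "rvec_of n (km_vertex S) \<in> set vs" if S: "S \<subseteq> {..<n}" "S \<noteq> {}" for S
  proof (rule obj_at_parameter[of n rho S])
    show "0 < n" using n by simp
    fix t y assume t: "0 \<le> t" and sl: "\<And>k. k < n \<Longrightarrow> slope n S y k = obj n k - t * (1 - rho k)"
      and y: "\<And>k. k < n \<Longrightarrow> k \<in> S \<Longrightarrow> 0 \<le> y k" "\<And>k. k < n \<Longrightarrow> k \<notin> S \<Longrightarrow> y k \<le> 0"
    have "(\<Sum>k<n. (obj n k - t * (1 - rho k)) * coord x k)
      \<le> (\<Sum>k<n. (obj n k - t * (1 - rho k)) * coord (rvec_of n (km_vertex S)) k)"
      if x: "x \<in> cut_cube n" for x
    proof -
      have "0 \<le> y k" if "k \<in> S" for k using y(1)[of k] S(1) that by blast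
      from km_vertex_optimal[of S y n, OF this y(2) x] show ?thesis by (simp add: sl)
    qed
    from maximized_at_cut_cube[OF wR om(1,2) km_vertex_in_cut_cube[OF S] t this]
    show ?thesis by (rule visit[OF extreme_point_km_vertex[OF n S]])
  qed (rule om(3))
  then show ?thesis using apex near by auto
qed

lemma inj_on_km_vertex: "inj_on (\<lambda>S. rvec_of n (km_vertex S)) (Pow {..<n})"
proof (rule inj_onI)
  fix S T assume ST: "S \<in> Pow {..<n}" "T \<in> Pow {..<n}"
    and eq: "rvec_of n (km_vertex S) = rvec_of n (km_vertex T)"
  have "k \<in> S \<longleftrightarrow> k \<in> T" for k
  proof (cases "k < n")
    case True
    then have "km_vertex S k = km_vertex T k" using arg_cong[OF eq, of "\<lambda>x. coord x k"] by simp
    then show ?thesis using km_vertex_pos km_vertex_out by (metis less_irrefl)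
  qed (use ST in auto)
  then show "S = T" by auto
qed

lemma shadow_path_cut_cube_length:
  assumes n: "2 \<le> n" and path: "shadow_path n (cut_cube n) (apex n) (rvec_of n (obj n)) w vs"
  shows "2 ^ n \<le> path_length vs"
proof -
  let ?U = "(\<lambda>S. rvec_of n (km_vertex S)) ` (Pow {..<n} - {{}})"
  have "card (Pow {..<n} - {{}}) = 2 ^ n - 1"
    by (subst card_Diff_singleton) (auto simp: card_Pow)
  then have U: "card ?U = 2 ^ n - 1" "finite ?U"
    using inj_on_subset[OF inj_on_km_vertex, of "Pow {..<n} - {{}}"] by (auto simp: card_image)
  \<comment> \<open>This separates the vertices of the cube from the two new ones, whose coordinates
    are at most 2.\<close>
  have big: "\<exists>k<n. 5 \<le> coord u k" if u: "u \<in> ?U" for u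
  proof -
    obtain S where S: "S \<subseteq> {..<n}" "S \<noteq> {}" "u = rvec_of n (km_vertex S)" using u by auto
    obtain k where k: "k \<in> S" using S by blast
    have m: "(LEAST k. k \<in> S) < n" using LeastI[of "\<lambda>k. k \<in> S", OF k] S by auto
    with km_vertex_Least[OF k] show ?thesis
      using S(3) km_bound_ge[of "LEAST k. k \<in> S"] by (intro exI[of _ "LEAST k. k \<in> S"]) simp
  qed
  have apex: "coord (apex n) k < 5" for k using apex_coord_bounds[OF n] by (simp add: apex_def)
  have "1 / (1 - eps n) \<le> 2" using eps_le[of n] by (simp add: field_simps)
  then have near: "coord (near_origin n) k < 5" for k by (simp add: near_origin_def)
  have "apex n \<noteq> near_origin n"
  proof
    assume "apex n = near_origin n"
    then have "coord (apex n) 1 = coord (near_origin n) 1" by simp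
    then show False using apex_coord_bounds[OF n] n by (auto simp: apex_def near_origin_def)
  qed
  moreover have "apex n \<notin> ?U" "near_origin n \<notin> ?U" using big apex near by (meson not_less)+
  ultimately have "card (insert (apex n) (insert (near_origin n) ?U)) = Suc (2 ^ n)"
    using U by simp
  then have "Suc (2 ^ n) \<le> card (set vs)"
    using card_mono[OF _ shadow_path_cut_cube_visits[OF n path]] by simp
  then show ?thesis using card_length[of vs] by (simp add: path_length_def)
qed

definition opt_vertex :: "nat \<Rightarrow> rvec" where
  "opt_vertex n = rvec_of n (km_vertex {n - 1})"

text \<open>The objective is \<open>2 ^ n\<close> times the last Klee-Minty row minus a combination,
  with positive weights, of the earlier coordinates. Equality forces these to vanish and that row to
  be tight.\<close>

lemma opt_vertex_maximal:
  assumes n: "2 \<le> n"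
  shows "opt_vertex n extreme_point_of cut_cube n" "opt_vertex n \<noteq> apex n"
    "uniquely_maximized_at (cut_cube n) (rvec_of n (obj n)) (opt_vertex n)"
proof -
  obtain m where m: "n = Suc m" using n by (cases n) auto
  have c: "coord (opt_vertex n) k = (if k = m then km_bound m else 0)" for k
    using km_vertex_Least[of m "{m}"] by (auto simp: opt_vertex_def m km_vertex_out Least_equality)
  show ext: "opt_vertex n extreme_point_of cut_cube n"
    unfolding opt_vertex_def by (rule extreme_point_km_vertex[OF n]) (use n in auto)
  then have mem: "opt_vertex n \<in> cut_cube n" by (simp add: extreme_point_of_def)
  have "coord (opt_vertex n) m \<noteq> coord (apex n) m"
    using c[of m] km_bound_ge[of m] apex_coord_bounds[OF n] by (simp add: apex_def m)
  then show "opt_vertex n \<noteq> apex n" by auto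
  have objective: "dotp (rvec_of n (obj n)) x
      = 2 ^ n * (coord x m + 2 * (\<Sum>k<m. coord x k)) - (\<Sum>k<m. 2 ^ Suc k * coord x k)" for x
    by (simp add: dotp_rvec_of m obj_def left_diff_distrib sum_subtractf sum_distrib_left algebra_simps)
  have opt: "dotp (rvec_of n (obj n)) (opt_vertex n) = 2 ^ n * km_bound m"
    unfolding objective by (simp add: c)
  have nn: "0 \<le> (\<Sum>k<m. 2 ^ Suc k * coord x k)" if "x \<in> cut_cube n" for x
    by (rule sum_nonneg) (use that m in \<open>auto simp: cut_cube_iff\<close>)
  have ub: "2 ^ n * (coord x m + 2 * (\<Sum>k<m. coord x k)) \<le> 2 ^ n * km_bound m" if "x \<in> cut_cube n" for x
    using that m by (intro mult_left_mono) (auto simp: cut_cube_iff)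
  have "maximized_at (cut_cube n) (rvec_of n (obj n)) (opt_vertex n)"
    unfolding maximized_at_def opt
  proof (intro conjI ballI)
    fix x assume x: "x \<in> cut_cube n"
    show "dotp (rvec_of n (obj n)) x \<le> 2 ^ n * km_bound m"
      unfolding objective using nn[OF x] ub[OF x] by linarith
  qed (rule mem)
  moreover have "x = opt_vertex n" if "maximized_at (cut_cube n) (rvec_of n (obj n)) x" for x
  proof -
    have x: "x \<in> cut_cube n" and ge: "2 ^ n * km_bound m \<le> dotp (rvec_of n (obj n)) x"
      using that mem opt by (auto simp: maximized_at_def)
    have nnk: "0 \<le> coord x k" if "k < n" for k using x that by (simp add: cut_cube_iff)
    have "(\<Sum>k<m. 2 ^ Suc k * coord x k) = 0"
      using ge nn[OF x] ub[OF x] unfolding objective by linarith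
    then have zero: "coord x k = 0" if "k < m" for k
      using that nnk m by (subst (asm) sum_nonneg_eq_0_iff) auto
    then have last: "coord x m = km_bound m"
      using ge ub[OF x] unfolding objective by simp
    show ?thesis
    proof (rule rvec_eqI)
      show "x \<in> Rn n" using x by (simp add: cut_cube_iff)
      show "opt_vertex n \<in> Rn n" by (simp add: opt_vertex_def)
      show "coord x i = coord (opt_vertex n) i" if "i < n" for i
        using that zero[of i] last c[of i] by (cases "i = m") (simp_all add: m)
    qed
  qed
  ultimately show "uniquely_maximized_at (cut_cube n) (rvec_of n (obj n)) (opt_vertex n)"
    unfolding uniquely_maximized_at_def by blast
qed

subsection \<open>The corresponding linear programs\<close>

definition row_list :: "nat \<Rightarrow> row list" where
  "row_list n = map Lo [0..<n] @ map Up [0..<n] @ map Cut [0..<n]"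

definition cut_cube_lp :: "nat \<Rightarrow> lp" where
  "cut_cube_lp n = \<lparr>lp_dim = n, lp_rows = map (\<lambda>r. (row_normal n r, row_bound r)) (row_list n),
     lp_obj = rvec_of n (obj n), lp_start = apex n\<rparr>"

lemma set_row_list: "set (row_list n) = rows n"
  by (auto simp: row_list_def rows_def)

lemma feasible_cut_cube_lp: "feasible (cut_cube_lp n) = cut_cube n"
  by (auto simp: feasible_def cut_cube_lp_def cut_cube_def set_row_list)

lemma input_size_cut_cube_lp: "input_size (cut_cube_lp n) = 3 * n * n + 5 * n"
  by (simp add: input_size_def cut_cube_lp_def row_list_def algebra_simps)

lemma rational_vec_rvec_of: "(\<And>i. i < n \<Longrightarrow> f i \<in> \<rat>) \<Longrightarrow> rational_vec n (rvec_of n f)"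
  by (simp add: rational_vec_def)

lemma eps_Rats: "eps n \<in> \<rat>"
  by (simp add: eps_def)

lemma shadow_instance_cut_cube_lp:
  assumes n: "2 \<le> n" shows "shadow_instance (cut_cube_lp n)"
proof -
  interpret simple_system n "rows n" "row_normal n" row_bound "cut_cube n"
    by (rule simple_system_cut_cube[OF n])
  have "rational_vec n (row_normal n r) \<and> row_bound r \<in> \<rat>" for r
    by (cases r) (auto simp: row_normal_def km_bound_def eps_Rats intro!: rational_vec_rvec_of)
  moreover have "rational_vec n (rvec_of n (obj n))"
    by (auto simp: obj_def intro!: rational_vec_rvec_of)
  moreover have "rational_vec n (apex n)"
    unfolding apex_def by (auto simp: eps_Rats intro!: rational_vec_rvec_of)
  ultimately show ?thesis
    using polytope_P extreme_point_apex[OF n] opt_vertex_maximal[OF n]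
    unfolding shadow_instance_def feasible_cut_cube_lp
    by (auto simp: cut_cube_lp_def)
qed

section \<open>Polynomials in the input size against \<open>2 ^ n\<close>\<close>

lemma poly_nat_le_monom:
  fixes p :: "nat poly" shows "\<exists>C d. \<forall>x\<ge>1. poly p x \<le> C * x ^ d"
proof (induction p)
  case 0
  show ?case by simp
next
  case (pCons a p)
  from pCons.IH obtain C d where C: "\<forall>x\<ge>1. poly p x \<le> C * x ^ d" by blast
  have "poly (pCons a p) x \<le> (a + C) * x ^ Suc d" if "x \<ge> 1" for x
  proof -
    have x: "poly p x \<le> C * x ^ d" using C that by simp
    have 1: "a * 1 \<le> a * x ^ Suc d" using that by (intro mult_left_mono) simp_all
    have "x * poly p x \<le> x * (C * x ^ d)" using x by (rule mult_left_mono) simp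
    with 1 have "a * 1 + x * poly p x \<le> a * x ^ Suc d + x * (C * x ^ d)" by (rule add_mono)
    then show ?thesis by (simp add: algebra_simps)
  qed
  then show ?case by (intro exI[of _ "a + C"] exI[of _ "Suc d"]) simp
qed

lemma poly_less_power2:
  fixes p :: "nat poly" shows "\<exists>n\<ge>2. poly p (3 * n * n + 5 * n) < 2 ^ n"
proof -
  obtain C d where "\<forall>x\<ge>1. poly p x \<le> C * x ^ d" using poly_nat_le_monom[of p] by blast
  then have C: "\<And>x. x \<ge> 1 \<Longrightarrow> poly p x \<le> C * x ^ d" by simp
  \<comment> \<open>\<open>2 ^ K\<close> dominates the constant \<open>C * 8 ^ d\<close>, and taking
    \<open>n\<close> to be a power of 2 reduces the claim to the exponents:
    \<open>K + q * (4 * d)\<close> is less than \<open>Suc q * Suc q\<close>, which is at most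
    \<open>n\<close>.\<close>
  define K where "K = Suc (C * 8 ^ d)"
  define q where "q = 4 * d + K"
  define n :: nat where "n = 2 ^ (2 * q)"
  have q: "1 \<le> q" by (simp add: q_def K_def)
  have "(2::nat) ^ 1 \<le> n" unfolding n_def by (rule power_increasing) (use q in auto)
  then have n2: "2 \<le> n" by simp
  then have "1 * n \<le> n * n" by (intro mult_right_mono) auto
  then have size: "3 * n * n + 5 * n \<le> 8 * n ^ 2" by (simp add: power2_eq_square)
  have "poly p (3 * n * n + 5 * n) \<le> C * (3 * n * n + 5 * n) ^ d"
    using n2 by (intro C) simp
  also have "\<dots> \<le> C * (8 * n ^ 2) ^ d"
    using size by (intro mult_left_mono power_mono) auto
  also have "\<dots> = (C * 8 ^ d) * 2 ^ (q * (4 * d))"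
    by (simp add: n_def power_mult_distrib power_mult[symmetric] algebra_simps)
  also have "\<dots> \<le> 2 ^ K * 2 ^ (q * (4 * d))"
    using less_exp[of K] by (intro mult_right_mono) (auto simp: K_def)
  also have "\<dots> = 2 ^ (K + q * (4 * d))" by (simp add: power_add)
  also have "\<dots> < 2 ^ n"
  proof (rule power_strict_increasing)
    have "Suc q * Suc q \<le> 2 ^ q * 2 ^ q" using Suc_leI[OF less_exp[of q]] by (intro mult_mono) auto
    also have "\<dots> = n" by (simp add: n_def power_add[symmetric] mult_2)
    finally show "K + q * (4 * d) < n" by (simp add: q_def algebra_simps)
  qed simp
  finally show ?thesis using n2 by blast
qed

theorem theorem1p1:
  shows "(\<forall>n::nat. n \<ge> 2 \<longrightarrow>
           (\<exists>P v vopt c.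
              P \<subseteq> Rn n \<and> simple_polytope P \<and> adim P = int n \<and>
              card {F. facet P F} = 3 * n \<and>
              v extreme_point_of P \<and> c \<in> Rn n \<and>
              vopt extreme_point_of P \<and> vopt \<noteq> v \<and> uniquely_maximized_at P c vopt \<and>
              (\<forall>w vs. shadow_path n P v c w vs \<longrightarrow> path_length vs \<ge> 2 ^ n)))
       \<and> (\<nexists>aux route ops. shadow_simplex_algorithm aux route ops \<and> strongly_polynomial_time ops)"
proof (intro conjI allI impI notI)
  fix n :: nat assume n: "2 \<le> n"
  interpret simple_system n "rows n" "row_normal n" row_bound "cut_cube n"
    by (rule simple_system_cut_cube[OF n])
  show "\<exists>P v vopt c.
              P \<subseteq> Rn n \<and> simple_polytope P \<and> adim P = int n \<and>
              card {F. facet P F} = 3 * n \<and>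
              v extreme_point_of P \<and> c \<in> Rn n \<and>
              vopt extreme_point_of P \<and> vopt \<noteq> v \<and> uniquely_maximized_at P c vopt \<and>
              (\<forall>w vs. shadow_path n P v c w vs \<longrightarrow> path_length vs \<ge> 2 ^ n)"
  proof (rule exI[of _ "cut_cube n"], rule exI[of _ "apex n"], rule exI[of _ "opt_vertex n"],
      rule exI[of _ "rvec_of n (obj n)"], intro conjI allI impI)
    show "cut_cube n \<subseteq> Rn n" using P_Rn by blast
    show "card {F. facet (cut_cube n) F} = 3 * n" by (simp only: card_facets card_rows)
    show "2 ^ n \<le> path_length vs" if "shadow_path n (cut_cube n) (apex n) (rvec_of n (obj n)) w vs" for w vs
      using n that by (rule shadow_path_cut_cube_length)
  qed (rule simple_polytope_P adim_P extreme_point_apex[OF n] rvec_of_in_Rn opt_vertex_maximal[OF n])+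
next
  assume "\<exists>aux route ops. shadow_simplex_algorithm aux route ops \<and> strongly_polynomial_time ops"
  then obtain aux route ops p where alg: "shadow_simplex_algorithm aux route ops"
    and p: "\<And>L. shadow_instance L \<Longrightarrow> ops L \<le> poly p (input_size L)"
    unfolding strongly_polynomial_time_def by blast
  obtain n where n: "2 \<le> n" "poly p (3 * n * n + 5 * n) < 2 ^ n"
    using poly_less_power2 by blast
  let ?L = "cut_cube_lp n"
  have inst: "shadow_instance ?L" by (rule shadow_instance_cut_cube_lp[OF n(1)])
  then have "shadow_path n (cut_cube n) (apex n) (rvec_of n (obj n)) (aux ?L) (route ?L)"
    and "path_length (route ?L) \<le> ops ?L"
    using alg feasible_cut_cube_lp[of n] unfolding shadow_simplex_algorithm_def
    by (auto simp: cut_cube_lp_def)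
  then have "2 ^ n \<le> ops ?L" using shadow_path_cut_cube_length[OF n(1)] by fastforce
  also have "\<dots> \<le> poly p (3 * n * n + 5 * n)"
    using p[OF inst] by (simp add: input_size_cut_cube_lp)
  finally show False using n(2) by simp
qed

end
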